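(* Let $k>2$ be a fixed integer and let $n\ge 1$ be an integer. We have $$\mathcal{D}_k(n)\le\min\{m\ge n: m\in\mathcal{A}_k\cup\mathcal{B}_k\},$$ with equality if the interval $[n,n/\sigma_k)$ contains an integer $m\in\mathcal{A}_k\cup\mathcal{B}_k$. We have $\sigma_k=2/3$ if $k\equiv 1$ or $7\pmod 9$, and $\sigma_k\le 3/5$ otherwise. If $\mathcal{D}_k(n)$ is even, then $$\mathcal{D}_k(n)\le\min\{m\ge n: m\in\mathcal{B}_k\},$$ with equality if the interval $[n,n/\tau_k)$ contains an integer $m\in\mathcal{B}_k$. If $k\equiv 0,2$ or $4\pmod 5$, then $\tau_k\le 7/13$, and $\tau_k\le 3/5$ for general $k$.
   Context: For an integer $k\ge 1$ let $U_0(k)=0$, $U_1(k)=1$, $U_{n+2}(k)=(4k+2)U_{n+1}(k)-U_n(k)$ for $n\ge 0$. For fixed $k$ these integers are pairwise distinct. The discriminator $\mathcal{D}_k(n)$ ($n\ge 1$) is the smallest integer $m\ge 1$ such that $U_0(k),\ldots,U_{n-1}(k)$ are pairwise incongruent modulo $m$. The sets $\mathcal{A}_k,\mathcal{B}_k$ of positive integers ($p$ denotes primes): $\mathcal{A}_k=\{m \text{ odd}: p\mid m\Rightarrow p\mid k\}$ if $k\not\equiv 6\pmod 9$, and $\mathcal{A}_k=\{m\text{ odd},\ 9\nmid m: p\mid m\Rightarrow p\mid k\}$ if $k\equiv 6\pmod 9$; $\mathcal{B}_k=\{m\text{ even}: p\mid m\Rightarrow p\mid k(k+1)\}$ if $k\not\equiv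 6\pmod 9$ and $k\not\equiv 2\pmod 9$, and $\mathcal{B}_k=\{m\text{ even},\ 9\nmid m: p\mid m\Rightarrow p\mid k(k+1)\}$ if $k\equiv 6\pmod 9$ or $k\equiv 2\pmod 9$. For $m\ge 1$ the index of appearance $z_k(m)$ is the smallest $n\ge 1$ such that $m\mid U_n(k)$ (it exists). Define $$\sigma_k=\sup_{p\text{ prime}}\Big\{\frac{z_k(p^2)}{p^2}: z_k(p^2)<p^2\Big\},\qquad \tau_k=\sup_{p\text{ prime}}\Big\{\frac{z_k(2p^2)}{2p^2}: z_k(2p^2)<2p^2\Big\}.$$ *)

theory Defs
  imports Complex_Main "HOL-Number_Theory.Cong" "HOL-Computational_Algebra.Primes"
begin

fun U :: "nat \<Rightarrow> nat \<Rightarrow> int" where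
  "U k 0 = 0"
| "U k (Suc 0) = 1"
| "U k (Suc (Suc n)) = (4 * int k + 2) * U k (Suc n) - U k n"

definition discriminator :: "nat \<Rightarrow> nat \<Rightarrow> nat" where
  "discriminator k n =
     (LEAST m. m \<ge> 1 \<and> (\<forall>i<n. \<forall>j<n. i \<noteq> j \<longrightarrow> \<not> [U k i = U k j] (mod int m)))"

definition A_set :: "nat \<Rightarrow> nat set" where
  "A_set k =
     (if [k = 6] (mod 9)
      then {m. odd m \<and> \<not> 9 dvd m \<and> (\<forall>p. prime p \<and> p dvd m \<longrightarrow> p dvd k)}
      else {m. odd m \<and> (\<forall>p. prime p \<and> p dvd m \<longrightarrow> p dvd k)})"

definition B_set :: "nat \<Rightarrow> nat set" where
  "B_set k =
     (if [k = 6] (mod 9) \<or> [k = 2] (mod 9)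
      then {m. m > 0 \<and> even m \<and> \<not> 9 dvd m \<and> (\<forall>p. prime p \<and> p dvd m \<longrightarrow> p dvd k * (k + 1))}
      else {m. m > 0 \<and> even m \<and> (\<forall>p. prime p \<and> p dvd m \<longrightarrow> p dvd k * (k + 1))})"

definition index_of_appearance :: "nat \<Rightarrow> nat \<Rightarrow> nat" where
  "index_of_appearance k m = (LEAST n. n \<ge> 1 \<and> int m dvd U k n)"

definition sigma :: "nat \<Rightarrow> real" where
  "sigma k = Sup {real (index_of_appearance k (p\<^sup>2)) / real (p\<^sup>2) | p.
                    prime p \<and> index_of_appearance k (p\<^sup>2) < p\<^sup>2}"

definition tau :: "nat \<Rightarrow> real" where
  "tau k = Sup {real (index_of_appearance k (2 * p\<^sup>2)) / real (2 * p\<^sup>2) | p.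
                  prime p \<and> index_of_appearance k (2 * p\<^sup>2) < 2 * p\<^sup>2}"

end

theory Submission
  imports Defs "HOL-Number_Theory.Residues"
begin

text \<open>Let \<open>\<alpha> = 2k + 1 + 2\<surd>(k(k + 1))\<close>, a unit of norm 1. Then \<open>U\<^sub>n = (\<alpha>\<^sup>n - \<alpha>\<^sup>-\<^sup>n) / (\<alpha> - \<alpha>\<^sup>-\<^sup>1)\<close>, a Lucas
sequence of discriminant \<open>16k(k + 1)\<close>. The main tool is the factorization of \<open>U\<^sub>i - U\<^sub>j\<close> into a
factor that depends on \<open>i - j\<close> and one that depends on \<open>i + j\<close> (\<open>U_diff_even\<close>, \<open>U_diff_odd\<close>), obtained
from \<open>\<alpha>\<close> when \<open>i - j\<close> is even and from its square root \<open>\<surd>(k + 1) + \<surd>k\<close> when \<open>i - j\<close> is odd.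

If all primes of \<open>m\<close> divide \<open>k(k + 1)\<close>, then \<open>m\<close> divides \<open>U\<^sub>m\<close>, and except for an anomaly of the prime
3, which occurs exactly when \<open>k\<close> is 2 or 6 modulo 9 and affects only multiples of 9, it divides
none of \<open>U\<^sub>1, \<dots>, U\<^sub>m\<^sub>-\<^sub>1\<close> (\<open>regular_dvd_U_imp_dvd\<close>). For moduli in the two sets the second factor of
\<open>U\<^sub>i - U\<^sub>j\<close> contributes nothing beyond a factor 2, so a congruence \<open>U\<^sub>i \<equiv> U\<^sub>j\<close> modulo \<open>m\<close> forces \<open>i \<equiv> j\<close>
modulo \<open>m\<close>, and \<open>m\<close> discriminates the first \<open>m\<close> terms. This gives the upper bounds. Powers of 2
belong to the second set, so the discriminator \<open>D\<close> of the first \<open>n\<close> terms is less than \<open>2n\<close>.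

Conversely, if \<open>m\<close> divides \<open>U\<^sub>N\<close> with \<open>N \<ge> 1\<close>, then a discriminating modulus \<open>m\<close> needs \<open>n \<le> N\<close>. A prime \<open>p\<close>
that does not divide \<open>k(k + 1)\<close> divides some \<open>U\<^sub>t\<close> with \<open>1 \<le> t \<le> (p + 1)/2\<close>. If the anomaly at 3
occurs, \<open>D\<close> is not divisible by 9, as this would force \<open>n \<le> D/3\<close>. Suppose that each prime not
dividing \<open>k(k + 1)\<close> divides \<open>D\<close> at most once. If any of them divides \<open>D\<close>, replacing each one by a
power of 2 in \<open>[(p + 1)/2, p)\<close> yields an integer \<open>b < D\<close> in the second set with \<open>n \<le> b\<close>, which is
impossible because \<open>b\<close> would discriminate. If none does, \<open>D\<close> misses both sets only when it is odd
with a prime factor dividing \<open>k + 1\<close>, and then the second factor of \<open>U\<^sub>i - U\<^sub>j\<close> produces a collision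
so early that a power of 2 does better. Hence \<open>D\<close> lies in one of the two sets or is divisible by
\<open>p\<^sup>2\<close> for a prime \<open>p\<close> not dividing \<open>k(k + 1)\<close> (\<open>discriminator_AB_or_square\<close>). In the latter case
\<open>n \<le> \<sigma> D\<close>, because the index of appearance of a multiple \<open>y d\<close> is at most \<open>y\<close> times that of \<open>d\<close>, and if
\<open>D\<close> is even, the same argument with \<open>2p\<^sup>2\<close> gives \<open>n \<le> \<tau> D\<close>. The short intervals in the statement
exclude this.

The bounds on the two suprema follow from the bound \<open>(p + 1)/2\<close>. The primes dividing \<open>k(k + 1)\<close>
contribute nothing except possibly a ratio 1/3 for \<open>p = 3\<close>. For the others the ratio for \<open>p\<^sup>2\<close> is at
most \<open>(p + 1)/(2p)\<close>, so only \<open>p = 3\<close> can exceed 3/5; the ratio for \<open>2p\<^sup>2\<close> exceeds 1/2 only if \<open>p \<equiv> 1\<close>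
modulo 4, so only \<open>p = 5\<close> can exceed 7/13.\<close>

section \<open>The Lucas sequence and its companion\<close>

text \<open>The companion sequence \<open>\<alpha>\<^sup>n + \<alpha>\<^sup>-\<^sup>n\<close>, written through \<open>U\<close> so that identities for it reduce to
polynomial identities in two consecutive terms of \<open>U\<close>.\<close>
definition V :: "nat \<Rightarrow> nat \<Rightarrow> int" where
  "V k n = 2 * U k (Suc n) - (4 * int k + 2) * U k n"

lemma U_add_Suc: "U k (Suc (m + n)) = U k (Suc m) * U k (Suc n) - U k m * U k n"
proof (induction m rule: less_induct)
  case (less m)
  consider "m = 0" | "m = Suc 0" | m' where "m = Suc (Suc m')"
    by (metis not0_implies_Suc)
  then show ?case
  proof cases
    case 3
    have "U k (Suc (Suc m' + n)) = U k (Suc (Suc m')) * U k (Suc n) - U k (Suc m') * U k n"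
      and "U k (Suc (m' + n)) = U k (Suc m') * U k (Suc n) - U k m' * U k n"
      by (rule less.IH, simp add: 3)+
    moreover have "U k (Suc (Suc (Suc m') + n))
        = (4 * int k + 2) * U k (Suc (Suc m' + n)) - U k (Suc (m' + n))"
      by simp
    ultimately have "U k (Suc (Suc (Suc m') + n))
        = (4 * int k + 2) * (U k (Suc (Suc m')) * U k (Suc n) - U k (Suc m') * U k n)
          - (U k (Suc m') * U k (Suc n) - U k m' * U k n)"
      by (simp only:)
    then show ?thesis
      unfolding 3 U.simps(3)[of k "Suc m'"] by (simp only: algebra_simps U.simps(3)[of k m'])
  qed auto
qed

lemma U_add:
  "U k (m + n) = U k m * U k (Suc n) + U k (Suc m) * U k n - (4 * int k + 2) * U k m * U k n"
proof (cases m)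
  case (Suc m')
  then show ?thesis
    using U_add_Suc[of k m' n] by (simp add: algebra_simps)
qed simp

text \<open>This says that \<open>\<alpha>\<^sup>n\<close> has norm 1. Together with the addition formulas it yields the factorizations
and duplication formulas for \<open>U\<close> and \<open>V\<close>.\<close>
lemma U_norm: "(U k (Suc n))\<^sup>2 - (4 * int k + 2) * U k (Suc n) * U k n + (U k n)\<^sup>2 = 1"
  by (induction n) (simp_all add: power2_eq_square algebra_simps)

text \<open>The addition formula with a negative shift: by the norm equation the step from \<open>j\<close> to \<open>j + e\<close>
has determinant 1 and can be inverted over the integers.\<close>
lemma U_shift_back:
  "U k (j + e) * U k (Suc e) - U k (Suc (j + e)) * U k e = U k j"
proof -
  have "U k (j + e) * U k (Suc e) - U k (Suc (j + e)) * U k e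
      = U k j * ((U k (Suc e))\<^sup>2 - (4 * int k + 2) * U k (Suc e) * U k e + (U k e)\<^sup>2)"
    unfolding U_add[of k j e] U_add_Suc[of k j e] by (simp add: power2_eq_square algebra_simps)
  then show ?thesis
    by (simp only: U_norm)
qed

lemma U_diff_even: "U k (j + 2 * e) - U k j = U k e * V k (j + e)"
proof -
  have "U k (j + 2 * e) = U k (j + e) * U k (Suc e) + U k (Suc (j + e)) * U k e
      - (4 * int k + 2) * U k (j + e) * U k e"
    using U_add[of k "j + e" e] by (simp add: mult_2 add.assoc)
  then show ?thesis
    using U_shift_back[of k j e] unfolding V_def by (simp add: algebra_simps)
qed

text \<open>In terms of \<open>\<beta> = \<surd>(k + 1) + \<surd>k\<close>, a square root of \<open>\<alpha>\<close>, the two factors are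
\<open>(\<beta>\<^sup>d - \<beta>\<^sup>-\<^sup>d) / (2\<surd>k)\<close> and \<open>(\<beta>\<^sup>s + \<beta>\<^sup>-\<^sup>s) / (2\<surd>(k + 1))\<close> for the odd numbers \<open>d = 2e + 1\<close> and
\<open>s = 2(j + e) + 1\<close>. Sums and differences of consecutive terms of \<open>U\<close> represent these
half-integral terms without leaving the integers.\<close>
lemma U_diff_odd:
  "U k (Suc (j + 2 * e)) - U k j
     = (U k (Suc e) + U k e) * (U k (Suc (j + e)) - U k (j + e))"
proof -
  have "U k (Suc (j + 2 * e)) = U k (Suc (j + e)) * U k (Suc e) - U k (j + e) * U k e"
    using U_add_Suc[of k "j + e" e] by (simp add: mult_2 add.assoc)
  then show ?thesis
    using U_shift_back[of k j e] by (simp add: algebra_simps)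
qed

lemma U_double: "U k (2 * n) = U k n * V k n"
  using U_diff_even[of k 0 n] by simp

lemma U_odd_factor: "U k (Suc (2 * e)) = (U k (Suc e) + U k e) * (U k (Suc e) - U k e)"
  using U_diff_odd[of k 0 e] by simp

lemma V_sq: "(V k n)\<^sup>2 = 4 + 16 * int k * (int k + 1) * (U k n)\<^sup>2"
proof -
  have "(V k n)\<^sup>2
      = 4 * ((U k (Suc n))\<^sup>2 - (4 * int k + 2) * U k (Suc n) * U k n + (U k n)\<^sup>2)
        + 16 * int k * (int k + 1) * (U k n)\<^sup>2"
    unfolding V_def by (simp add: power2_eq_square algebra_simps)
  then show ?thesis by (simp only: U_norm)
qed

lemma V_double: "V k (2 * n) = 2 + 16 * int k * (int k + 1) * (U k n)\<^sup>2"
proof -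
  have "U k (Suc (2 * n)) = (U k (Suc n))\<^sup>2 - (U k n)\<^sup>2"
    using U_odd_factor[of k n] by (simp add: power2_eq_square algebra_simps)
  then have "V k (2 * n)
      = 2 * ((U k (Suc n))\<^sup>2 - (4 * int k + 2) * U k (Suc n) * U k n + (U k n)\<^sup>2)
        + 16 * int k * (int k + 1) * (U k n)\<^sup>2"
    unfolding V_def[of k "2 * n"] U_double V_def[of k n]
    by (simp add: power2_eq_square algebra_simps)
  then show ?thesis
    by (simp only: U_norm)
qed

text \<open>Summing the differences \<open>U\<^sub>(\<^sub>2\<^sub>i\<^sub>+\<^sub>1\<^sub>)\<^sub>l - U\<^sub>(\<^sub>2\<^sub>i\<^sub>-\<^sub>1\<^sub>)\<^sub>l = U\<^sub>l V\<^sub>2\<^sub>i\<^sub>l\<close>. For an odd prime \<open>2h + 1\<close>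
dividing \<open>k(k + 1)\<close> the quotient of \<open>U\<close> at \<open>(2h + 1)l\<close> and at \<open>l\<close> is visibly divisible by that prime, and the
sum of squares decides whether a second power divides it.\<close>
lemma U_odd_multiple:
  "U k ((2 * h + 1) * l)
     = U k l * (int (2 * h + 1) + 16 * int k * (int k + 1) * (\<Sum>i=1..h. (U k (i * l))\<^sup>2))"
proof (induction h)
  case (Suc h)
  have "U k ((2 * Suc h + 1) * l) = U k ((2 * h + 1) * l) + U k l * V k (2 * (Suc h * l))"
    using U_diff_even[of k "(2 * h + 1) * l" l] by (simp add: algebra_simps)
  also have "\<dots> = U k l * (int (2 * Suc h + 1)
      + 16 * int k * (int k + 1) * (\<Sum>i=1..Suc h. (U k (i * l))\<^sup>2))"
    unfolding Suc V_double by (simp add: algebra_simps)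
  finally show ?case .
qed simp

text \<open>Converts information on \<open>V\<close> at a prime index \<open>2h + 1\<close> into information on the two terms of
\<open>U\<close> around half that index.\<close>
lemma V_odd: "V k (Suc (2 * h)) = 4 * int k + 2 + 16 * int k * (int k + 1) * (U k h * U k (Suc h))"
proof -
  define a b where "a = U k h" and "b = U k (Suc h)"
  have 1: "U k (Suc (2 * h)) = b\<^sup>2 - a\<^sup>2"
    using U_odd_factor[of k h] unfolding a_def b_def
    by (simp add: power2_eq_square algebra_simps)
  have 2: "U k (2 * h) = a * (2 * b - (4 * int k + 2) * a)"
    using U_double[of k h] unfolding a_def b_def V_def .
  have "b\<^sup>2 - (4 * int k + 2) * b * a + a\<^sup>2 = 1"
    using U_norm[of k h] unfolding a_def b_def .
  then have ab: "a\<^sup>2 + b\<^sup>2 = 1 + (4 * int k + 2) * (a * b)"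
    by (simp add: algebra_simps)
  have "V k (Suc (2 * h)) = (4 * int k + 2) * (a\<^sup>2 + b\<^sup>2) - 4 * (a * b)"
    unfolding V_def U.simps(3) 1 2 by (simp add: algebra_simps power2_eq_square)
  then show ?thesis
    unfolding ab a_def[symmetric] b_def[symmetric] by (simp add: algebra_simps)
qed

lemma U_dvd_U_mult: "U k n dvd U k (t * n)"
proof (induction t)
  case (Suc t)
  then show ?case
    using U_add[of k n "t * n"] by (auto intro!: dvd_diff dvd_add dvd_mult)
qed simp

lemma U_parity: "even (U k n) \<longleftrightarrow> even n"
  by (induction k n rule: U.induct) auto

text \<open>Hence \<open>V\<close> is always twice an odd number, so doubling an index adds exactly one factor 2.\<close>
lemma V_mod_4: "V k n mod 4 = 2"
proof -
  have "odd (U k (Suc n)) \<or> odd (U k n)"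
    using U_parity[of k n] U_parity[of k "Suc n"] by auto
  moreover have "even (U k (Suc n)) \<or> even (U k n)"
    using U_parity[of k n] U_parity[of k "Suc n"] by auto
  ultimately have "odd (U k (Suc n) - U k n)" by auto
  then obtain c where "U k (Suc n) - U k n = 2 * c + 1" by (rule oddE)
  then have "V k n = 4 * (c - int k * U k n) + 2"
    unfolding V_def by (simp add: algebra_simps)
  then show ?thesis by presburger
qed

lemma U_cong_index_mod_k: "[U k n = int n] (mod int k)"
proof (induction k n rule: U.induct)
  case (3 k n)
  have "[(4 * int k + 2) * U k (Suc n) - U k n = (4 * 0 + 2) * int (Suc n) - int n] (mod int k)"
    by (intro cong_diff cong_mult cong_add 3) (auto simp: cong_0_iff)
  then show ?case by (simp add: algebra_simps)
qed simp_all

lemma U_cong_index_mod_k1: "[U k n = (-1) ^ Suc n * int n] (mod int k + 1)"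
proof (induction k n rule: U.induct)
  case (3 k n)
  have "[4 * int k + 2 = -2] (mod int k + 1)"
    by (simp add: cong_iff_dvd_diff dvd_def) (rule exI[of _ 4], simp)
  then have "[(4 * int k + 2) * U k (Suc n) - U k n
      = (-2) * ((-1) ^ Suc (Suc n) * int (Suc n)) - (-1) ^ Suc n * int n] (mod int k + 1)"
    by (intro cong_diff cong_mult 3)
  then show ?case by (simp add: algebra_simps)
qed simp_all

section \<open>Primes that do not divide the discriminant\<close>

lemma unramified_odd:
  fixes p k :: nat
  assumes p: "prime p" and nd: "\<not> p dvd k * (k + 1)"
  shows "odd p \<and> p \<ge> 3"
proof -
  have "odd p" using nd primes_dvd_imp_eq[OF two_is_prime_nat p] by auto
  then show ?thesis using prime_ge_2_nat[OF p] by presburger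
qed

text \<open>Recorded only to reach the binomial expansion of \<open>V\<close>; the square root disappears again there.\<close>
lemma V_eq_conjugate_powers:
  fixes k n :: nat
  defines "w \<equiv> real (2 * k + 1)" and "s \<equiv> sqrt (real (4 * k * (k + 1)))"
  shows "of_int (V k n) = (w + s) ^ n + (w - s) ^ n"
proof -
  have "s ^ 2 = real (4 * k * (k + 1))"
    unfolding s_def by (rule real_sqrt_pow2) simp
  then have s2: "s * s = 4 * real k * (real k + 1)"
    by (simp only: power2_eq_square of_nat_mult of_nat_add of_nat_1 of_nat_numeral)
  have ab: "(w + s) * (w - s) = 1" "(w + s) + (w - s) = 4 * real k + 2"
    using s2 unfolding w_def by (simp_all add: algebra_simps)
  show ?thesis
  proof (induction n rule: less_induct)
    case (less n)
    consider "n = 0" | "n = Suc 0" | m where "n = Suc (Suc m)"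
      by (metis not0_implies_Suc)
    then show ?case
    proof cases
      case 2
      then show ?thesis using ab by (simp add: V_def)
    next
      case (3 m)
      have rec: "V k n = (4 * int k + 2) * V k (Suc m) - V k m"
        unfolding 3 V_def by (simp add: algebra_simps)
      have IH: "of_int (V k (Suc m)) = (w + s) ^ Suc m + (w - s) ^ Suc m"
        "of_int (V k m) = (w + s) ^ m + (w - s) ^ m"
        by (rule less.IH, simp add: 3)+
      have gen: "(a + b) * (a ^ Suc m + b ^ Suc m) - a * b * (a ^ m + b ^ m)
          = a ^ n + b ^ n" for a b :: real
        unfolding 3 by (simp add: algebra_simps)
      show ?thesis
        using gen[of "w + s" "w - s"] unfolding rec ab
        by (simp only: of_int_diff of_int_mult IH) simp
    qed (simp add: V_def)
  qed
qed

lemma V_binomial: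
  "V k n = (\<Sum>i\<le>n. int (n choose i) * (2 * int k + 1) ^ (n - i)
     * (if even i then 2 * (4 * int k * (int k + 1)) ^ (i div 2) else 0))"
proof -
  define w where "w = real (2 * k + 1)"
  define s where "s = sqrt (real (4 * k * (k + 1)))"
  have "s ^ 2 = real (4 * k * (k + 1))"
    unfolding s_def by (rule real_sqrt_pow2) simp
  then have s2: "s ^ 2 = of_int (4 * int k * (int k + 1))"
    by (simp only: of_nat_mult of_nat_add of_nat_1 of_nat_numeral of_int_mult of_int_add of_int_1
        of_int_numeral of_int_of_nat_eq)
  have pow: "s ^ i + (- s) ^ i
      = of_int (if even i then 2 * (4 * int k * (int k + 1)) ^ (i div 2) else 0)" for i
  proof (cases "even i")
    case True
    then obtain j where "i = 2 * j" by (rule evenE)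
    then show ?thesis by (simp only: power_mult power_even_eq power2_minus s2) simp
  qed simp
  have "of_int (V k n) = (s + w) ^ n + (- s + w) ^ n"
    using V_eq_conjugate_powers[of k n] unfolding w_def s_def by (simp add: add.commute)
  also have "\<dots> = (\<Sum>i\<le>n. of_nat (n choose i) * w ^ (n - i) * (s ^ i + (- s) ^ i))"
    unfolding binomial_ring sum.distrib[symmetric] by (intro sum.cong) (auto simp: algebra_simps)
  also have "\<dots> = of_int (\<Sum>i\<le>n. int (n choose i) * (2 * int k + 1) ^ (n - i)
     * (if even i then 2 * (4 * int k * (int k + 1)) ^ (i div 2) else 0))"
    unfolding pow w_def by (simp add: add.commute)
  finally show ?thesis
    by (simp only: of_int_eq_iff)
qed

text \<open>The Frobenius map fixes the trace of \<open>\<alpha>\<close>: modulo \<open>p\<close> only the extreme binomial coefficients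
survive, the last one belongs to an odd power of the square root and cancels between the conjugates,
and Fermat's little theorem treats the first.\<close>
lemma V_prime_cong:
  assumes "prime p" "odd p"
  shows "[V k p = 4 * int k + 2] (mod int p)"
proof -
  define f where "f i = int (p choose i) * (2 * int k + 1) ^ (p - i)
     * (if even i then 2 * (4 * int k * (int k + 1)) ^ (i div 2) else 0)" for i
  have p0: "p > 0" using assms(1) by (simp add: prime_gt_0_nat)
  have "{..p} = insert 0 (insert p {1..<p})" using p0 by auto
  then have "V k p = f 0 + (f p + sum f {1..<p})"
    unfolding V_binomial f_def[symmetric] using p0 by simp
  moreover have "f p = 0" using assms(2) by (simp add: f_def)
  moreover have "int p dvd sum f {1..<p}"
  proof (rule dvd_sum)
    fix i assume "i \<in> {1..<p}"
    then have "p dvd (p choose i)"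
      using dvd_choose_prime[of i p] assms(1) by auto
    then show "int p dvd f i"
      unfolding f_def by (simp add: dvd_mult2)
  qed
  ultimately have "[V k p = f 0] (mod int p)"
    by (simp add: cong_iff_dvd_diff)
  moreover have "[(2 * k + 1) ^ p = 2 * k + 1] (mod p)"
  proof (cases "p dvd 2 * k + 1")
    case True
    then show ?thesis using p0 by (metis cong_0_iff cong_sym cong_trans dvd_power dvd_trans)
  next
    case False
    then have "[(2 * k + 1) ^ (p - 1) * (2 * k + 1) = 1 * (2 * k + 1)] (mod p)"
      using fermat_theorem[OF assms(1)] by (intro cong_mult) auto
    then show ?thesis using p0
      by (metis mult.left_neutral power_minus_mult)
  qed
  then have "[2 * (2 * int k + 1) ^ p = 2 * (2 * int k + 1)] (mod int p)"
    unfolding cong_int_iff[symmetric] by (intro cong_mult) (auto simp: add.commute)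
  ultimately show ?thesis
    by (simp add: f_def mult.commute) (smt (verit) cong_trans)
qed

text \<open>\<open>U\<^sub>t\<close> vanishes modulo \<open>p\<close> when \<open>\<alpha>\<^sup>2\<^sup>t = 1\<close>, and the Frobenius map sends the norm 1 element
\<open>\<alpha>\<close> to itself or to its inverse, so \<open>\<alpha>\<^sup>p\<^sup>-\<^sup>1 = 1\<close> or \<open>\<alpha>\<^sup>p\<^sup>+\<^sup>1 = 1\<close>. In elementary terms,
\<open>V\<^sub>p \<equiv> V\<^sub>1\<close> makes \<open>p\<close> divide \<open>U\<^sub>h U\<^sub>h\<^sub>+\<^sub>1\<close> with \<open>h = (p - 1)/2\<close>.\<close>
lemma prime_dvd_U_half:
  assumes p: "prime p" and nd: "\<not> p dvd k * (k + 1)"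
  shows "int p dvd U k ((p - 1) div 2) \<or> int p dvd U k ((p + 1) div 2)"
proof -
  have "odd p" using unramified_odd[OF p nd] by simp
  then obtain h where h: "p = Suc (2 * h)" by (auto elim!: oddE)
  have "[4 * int k + 2 + 16 * int k * (int k + 1) * (U k h * U k (Suc h)) = 4 * int k + 2] (mod int p)"
    using V_prime_cong[OF p \<open>odd p\<close>, of k] unfolding h V_odd .
  then have "int p dvd 2 ^ 4 * (int (k * (k + 1)) * (U k h * U k (Suc h)))"
    by (simp add: cong_iff_dvd_diff algebra_simps)
  moreover have "\<not> int p dvd 2 ^ 4"
  proof
    assume "int p dvd 2 ^ 4"
    then have "p dvd 2 ^ 4" by (metis int_dvd_int_iff of_nat_numeral of_nat_power)
    then have "p dvd 2" using p prime_dvd_power by blast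
    then show False using \<open>odd p\<close> p primes_dvd_imp_eq two_is_prime_nat by blast
  qed
  moreover have "\<not> int p dvd int (k * (k + 1))"
    using nd int_dvd_int_iff by blast
  moreover have "prime (int p)" using p by simp
  ultimately have "int p dvd U k h \<or> int p dvd U k (Suc h)"
    by (metis prime_dvd_mult_iff)
  then show ?thesis by (simp add: h)
qed

lemma prime_dvd_U_early:
  assumes p: "prime p" and nd: "\<not> p dvd k * (k + 1)"
  shows "\<exists>t\<ge>1. t \<le> (p + 1) div 2 \<and> int p dvd U k t"
proof -
  have "p \<ge> 3" using unramified_odd[OF p nd] by simp
  then have "(p - 1) div 2 \<ge> 1" "(p + 1) div 2 \<ge> 1" "(p - 1) div 2 \<le> (p + 1) div 2"
    by auto
  then show ?thesis
    using prime_dvd_U_half[OF p nd] by blast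
qed

section \<open>Primes that divide the discriminant\<close>

text \<open>For these residues, and no others, 3 divides \<open>k(k + 1)\<close> and 9 divides \<open>U\<^sub>3\<close>, so that the index
of appearance of 9 drops to 3.\<close>
definition exceptional :: "nat \<Rightarrow> bool" where
  "exceptional k \<longleftrightarrow> [k = 2] (mod 9) \<or> [k = 6] (mod 9)"

lemma prime_dvd_int_cases:
  assumes "prime p" "p dvd k * (k + 1)"
  shows "int p dvd int k \<or> int p dvd int k + 1"
proof -
  have "p dvd k \<or> p dvd k + 1" using assms prime_dvd_mult_iff by blast
  then show ?thesis by (metis int_dvd_int_iff of_nat_1 of_nat_add)
qed

text \<open>The sign in \<open>U\<^sub>n \<equiv> \<plusminus>n\<close>, which depends on whether \<open>p\<close> divides \<open>k\<close> or \<open>k + 1\<close>, disappears on squaring;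
this allows one treatment of both kinds of primes.\<close>
lemma U_sq_cong:
  assumes "prime p" "p dvd k * (k + 1)"
  shows "[(U k n)\<^sup>2 = (int n)\<^sup>2] (mod int p)"
  using prime_dvd_int_cases[OF assms]
proof
  assume "int p dvd int k"
  then show ?thesis
    using U_cong_index_mod_k cong_dvd_modulus cong_pow by blast
next
  assume "int p dvd int k + 1"
  then have "[(U k n)\<^sup>2 = ((-1) ^ Suc n * int n)\<^sup>2] (mod int p)"
    using U_cong_index_mod_k1 cong_dvd_modulus cong_pow by blast
  then show ?thesis by (simp add: power_mult_distrib flip: power_mult)
qed

lemma ramified_prime_dvd_U_iff:
  assumes "prime p" "p dvd k * (k + 1)"
  shows "int p dvd U k n \<longleftrightarrow> p dvd n"
proof -
  have "int p dvd (U k n)\<^sup>2 \<longleftrightarrow> int p dvd (int n)\<^sup>2"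
    using U_sq_cong[OF assms] by (rule cong_dvd_iff)
  then show ?thesis
    using assms(1) by (simp add: prime_dvd_power_iff)
qed

text \<open>In \<open>U_odd_multiple\<close> both summands of the quotient of \<open>U\<close> at \<open>p l\<close> and at \<open>l\<close> are divisible by \<open>p\<close>.\<close>
lemma prime_mult_U_dvd:
  assumes p: "prime p" and r: "p dvd k * (k + 1) \<or> int p dvd U k l"
  shows "int p * U k l dvd U k (p * l)"
proof (cases "p = 2")
  case True
  have "even (V k l)" using V_mod_4[of k l] by presburger
  then show ?thesis unfolding True U_double by (auto elim!: evenE)
next
  case False
  then have "odd p" using p primes_dvd_imp_eq[OF two_is_prime_nat p] by auto
  then obtain h where h: "p = 2 * h + 1" by (rule oddE)
  define T where "T = (\<Sum>i=1..h. (U k (i * l))\<^sup>2)"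
  have "int p dvd int (k * (k + 1)) * T"
    using r
  proof
    assume "p dvd k * (k + 1)"
    then show ?thesis by (meson dvd_mult2 int_dvd_int_iff)
  next
    assume a: "int p dvd U k l"
    have "int p dvd T" unfolding T_def
      by (rule dvd_sum) (metis U_dvd_U_mult a dvd_power dvd_trans pos2)
    then show ?thesis by simp
  qed
  then have "int p dvd int p + 16 * (int (k * (k + 1)) * T)"
    by (simp add: dvd_mult)
  moreover have "U k (p * l) = U k l * (int p + 16 * (int (k * (k + 1)) * T))"
    unfolding h U_odd_multiple T_def[symmetric] by (simp add: algebra_simps)
  ultimately show ?thesis
    by (simp add: mult.commute mult_dvd_mono)
qed

lemma sum_squares_6: "6 * (\<Sum>i=1..h. (int i)\<^sup>2) = int h * (int h + 1) * (2 * int h + 1)"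
  by (induction h) (auto simp: algebra_simps power2_eq_square)

text \<open>Multiplying the index by \<open>p\<close> raises the exponent of \<open>p\<close> in \<open>U\<close> by exactly one. For \<open>p \<ge> 5\<close> the
sum of squares in \<open>U_odd_multiple\<close> is congruent to a multiple of \<open>1\<^sup>2 + \<dots> + h\<^sup>2\<close>, which \<open>p = 2h + 1\<close> divides; for
\<open>p = 3\<close> that sum is a single square and the quotient has to be computed modulo 9.\<close>
lemma U_prime_multiple_exact:
  assumes p: "prime p" and r: "p dvd k * (k + 1)"
    and three: "p = 3 \<Longrightarrow> 3 dvd l \<or> \<not> exceptional k"
  shows "\<exists>s. U k (p * l) = U k l * (int p * s) \<and> \<not> int p dvd s"
proof -
  consider "p = 2" | "p = 3" | "p \<ge> 5"
  proof -
    have "p \<noteq> 4"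
      using p primes_dvd_imp_eq[OF two_is_prime_nat p] by auto
    with prime_ge_2_nat[OF p] have "p = 2 \<or> p = 3 \<or> p \<ge> 5" by linarith
    then show thesis using that by blast
  qed
  then show ?thesis
  proof cases
    case 1
    have "V k l = 2 * (2 * (V k l div 4) + 1)"
      using V_mod_4[of k l] by presburger
    then show ?thesis unfolding 1 U_double by (intro exI[of _ "2 * (V k l div 4) + 1"]) auto
  next
    case 2
    obtain c where c: "k * (k + 1) = 3 * c" using r 2 by (auto elim!: dvdE)
    have ic: "int k * (int k + 1) = 3 * int c"
      using c by (metis of_nat_1 of_nat_add of_nat_mult of_nat_numeral)
    have "U k (3 * l) = U k l * (3 + 16 * (int k * (int k + 1)) * (U k l)\<^sup>2)"
      using U_odd_multiple[of k 1 l] by (simp add: algebra_simps numeral_eq_Suc)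
    then have "U k (3 * l) = U k l * (3 * (1 + 16 * int c * (U k l)\<^sup>2))"
      unfolding ic by (simp add: algebra_simps)
    moreover have "\<not> 3 dvd 1 + 16 * int c * (U k l)\<^sup>2"
    proof (cases "3 dvd l")
      case True
      then have "3 dvd U k l" using ramified_prime_dvd_U_iff[OF p r, of l] 2 by simp
      then have "3 dvd 16 * int c * (U k l)\<^sup>2" by (simp add: dvd_mult power2_eq_square)
      then show ?thesis by presburger
    next
      case False
      have "[(U k l)\<^sup>2 = (int l)\<^sup>2] (mod 3)"
        using U_sq_cong[OF p r, of l] 2 by simp
      also have "[(int l)\<^sup>2 = 1] (mod 3)"
      proof -
        have "int l mod 3 = 1 \<or> int l mod 3 = 2" using False by presburger
        then show ?thesis by (auto simp: cong_def power2_eq_square mod_mult_eq[of "int l", symmetric])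
      qed
      finally have "[1 + 16 * int c * (U k l)\<^sup>2 = 1 + 16 * int c * 1] (mod 3)"
        by (intro cong_add cong_mult) auto
      then have "3 dvd 1 + 16 * int c * (U k l)\<^sup>2 \<longleftrightarrow> 3 dvd 1 + 16 * int c * 1"
        by (rule cong_dvd_iff)
      moreover have "\<not> 3 dvd 1 + 16 * int c"
      proof
        \<comment> \<open>this would mean \<open>k(k + 1) \<equiv> 6\<close> modulo 9\<close>
        assume "3 dvd 1 + 16 * int c"
        then have "int c mod 3 = 2" by presburger
        then have "c mod 3 = 2" by presburger
        then have "3 * c mod 9 = 6" using mult_mod_right[of 3 c 3] by simp
        then have *: "k * (k + 1) mod 9 = 6" using c by simp
        define r where "r = k mod 9"
        have "r < 9" by (simp add: r_def)
        then have "r = 0 \<or> r = 1 \<or> r = 2 \<or> r = 3 \<or> r = 4 \<or> r = 5 \<or> r = 6 \<or> r = 7 \<or> r = 8"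
          by (auto simp: less_Suc_eq numeral_eq_Suc)
        moreover have "[r * (r + 1) = k * (k + 1)] (mod 9)"
          unfolding r_def by (intro cong_mult cong_add) (auto simp: cong_def)
        then have "r * (r + 1) mod 9 = 6"
          using * by (simp only: cong_def)
        ultimately have "r = 2 \<or> r = 6" by (elim disjE) simp_all
        then show False using three 2 False by (auto simp: exceptional_def cong_def r_def)
      qed
      ultimately show ?thesis by simp
    qed
    ultimately show ?thesis unfolding 2 by (intro exI[of _ "1 + 16 * int c * (U k l)\<^sup>2"]) simp
  next
    case 3
    then have "odd p" using p primes_dvd_imp_eq[OF two_is_prime_nat p] by auto
    then obtain h where h: "p = 2 * h + 1" by (rule oddE)
    define T where "T = (\<Sum>i=1..h. (U k (i * l))\<^sup>2)"
    have "[T = (\<Sum>i=1..h. (int (i * l))\<^sup>2)] (mod int p)"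
      unfolding T_def by (intro cong_sum U_sq_cong p r)
    also have "(\<Sum>i=1..h. (int (i * l))\<^sup>2) = (int l)\<^sup>2 * (\<Sum>i=1..h. (int i)\<^sup>2)"
      unfolding sum_distrib_left by (simp add: power_mult_distrib mult.commute)
    finally have T: "int p dvd T \<longleftrightarrow> int p dvd (int l)\<^sup>2 * (\<Sum>i=1..h. (int i)\<^sup>2)"
      by (rule cong_dvd_iff)
    have "int p dvd 6 * (\<Sum>i=1..h. (int i)\<^sup>2)"
      unfolding sum_squares_6 using h by (intro dvd_mult) (simp add: add.commute)
    moreover have "\<not> int p dvd 6"
    proof
      assume "int p dvd 6"
      then have "p dvd 2 * 3" by presburger
      then have "p dvd 2 \<or> p dvd 3" using p prime_dvd_mult_iff by blast
      then show False using 3 by (auto dest: dvd_imp_le)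
    qed
    ultimately have "int p dvd (\<Sum>i=1..h. (int i)\<^sup>2)"
      using p by (metis prime_dvd_mult_iff prime_nat_int_transfer)
    then have "int p dvd T" unfolding T by simp
    then obtain t where t: "T = int p * t" by (rule dvdE)
    have "int p dvd int (k * (k + 1))" using r int_dvd_int_iff by blast
    then obtain d where d: "int (k * (k + 1)) = int p * d" by (rule dvdE)
    have "U k (p * l) = U k l * (int p + 16 * (int (k * (k + 1)) * T))"
      unfolding h U_odd_multiple T_def[symmetric] by (simp add: algebra_simps)
    also have "\<dots> = U k l * (int p * (1 + int p * (16 * d * t)))"
      unfolding d t by (simp add: algebra_simps)
    finally have "U k (p * l) = U k l * (int p * (1 + int p * (16 * d * t)))" .
    moreover have "\<not> int p dvd 1 + int p * (16 * d * t)"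
      using 3 by (simp add: dvd_add_left_iff)
    ultimately show ?thesis by blast
  qed
qed

text \<open>Induction on the exponent: one factor \<open>p\<close> of \<open>n\<close> is removed together with exactly one factor \<open>p\<close>
of \<open>U\<^sub>n\<close>.\<close>
lemma prime_power_dvd_U_imp_dvd:
  assumes p: "prime p" and r: "p dvd k * (k + 1)"
    and three: "p = 3 \<Longrightarrow> exceptional k \<Longrightarrow> a \<le> 1"
    and "int p ^ a dvd U k n"
  shows "p ^ a dvd n"
  using three assms(4)
proof (induction a arbitrary: n)
  case (Suc a)
  have "int p dvd U k n" using Suc.prems(2) by (auto intro: dvd_trans)
  then have "p dvd n" using ramified_prime_dvd_U_iff[OF p r] by simp
  then obtain l where l: "n = p * l" by (rule dvdE)
  show ?case
  proof (cases "a = 0")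
    case True
    then show ?thesis using \<open>p dvd n\<close> by simp
  next
    case False
    then have "p = 3 \<Longrightarrow> 3 dvd l \<or> \<not> exceptional k"
      using Suc.prems(1) by auto
    then obtain s where s: "U k n = U k l * (int p * s)" "\<not> int p dvd s"
      using U_prime_multiple_exact[OF p r, of l] l by auto
    have "int p * int p ^ a dvd int p * (s * U k l)"
      using Suc.prems(2) unfolding s(1) by (simp add: ac_simps)
    then have "int p ^ a dvd s * U k l"
      using p by (simp add: prime_gt_0_nat)
    moreover have "prime_elem (int p)" using p by (simp add: prime_imp_prime_elem)
    ultimately have "int p ^ a dvd U k l"
      using prime_power_dvd_multD[of "int p" a s "U k l"] s(2) False by blast
    then have "p ^ a dvd l"
      using Suc.IH Suc.prems(1) by force
    then show ?thesis by (simp add: l)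
  qed
qed simp

text \<open>The moduli all of whose primes ramify, that is, divide the discriminant \<open>16k(k + 1)\<close>; the
prime 2 is covered because \<open>k(k + 1)\<close> is even.\<close>
definition ramified :: "nat \<Rightarrow> nat \<Rightarrow> bool" where
  "ramified k m \<longleftrightarrow> m > 0 \<and> (\<forall>p. prime p \<and> p dvd m \<longrightarrow> p dvd k * (k + 1))"

text \<open>The ramified moduli not affected by the anomaly at 9; the two sets of the theorem consist of
such moduli.\<close>
definition regular :: "nat \<Rightarrow> nat \<Rightarrow> bool" where
  "regular k m \<longleftrightarrow> ramified k m \<and> (exceptional k \<longrightarrow> \<not> 9 dvd m)"

lemma ramified_dvd: "ramified k m \<Longrightarrow> d dvd m \<Longrightarrow> ramified k d"
  unfolding ramified_def by (metis dvd_trans dvd_0_left_iff gr0I)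

lemma ramified_mult: "ramified k x \<Longrightarrow> ramified k y \<Longrightarrow> ramified k (x * y)"
  unfolding ramified_def by (metis nat_0_less_mult_iff prime_dvd_mult_iff)

lemma regular_dvd: "regular k m \<Longrightarrow> d dvd m \<Longrightarrow> regular k d"
  unfolding regular_def using ramified_dvd dvd_trans by blast

lemma regular_dvd_U_imp_dvd:
  assumes "regular k m" and d: "int m dvd U k n"
  shows "m dvd n"
proof (cases "n = 0")
  case False
  show ?thesis
  proof (rule multiplicity_le_imp_dvd)
    show "m \<noteq> 0" using assms(1) by (simp add: regular_def ramified_def)
  next
    fix p :: nat assume p: "prime p"
    define a where "a = multiplicity p m"
    have pa: "p ^ a dvd m" unfolding a_def by (rule multiplicity_dvd)
    show "multiplicity p m \<le> multiplicity p n"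
    proof (cases "a = 0")
      case False
      then have "p dvd m" using pa by (meson dvd_power dvd_trans gr0I)
      then have "p dvd k * (k + 1)"
        using assms(1) p by (simp add: regular_def ramified_def)
      moreover have "a \<le> 1" if "p = 3" "exceptional k"
      proof (rule ccontr)
        assume "\<not> a \<le> 1"
        then have "p ^ 2 dvd p ^ a" by (intro le_imp_power_dvd) simp
        then have "p ^ 2 dvd m" using pa by (rule dvd_trans)
        then show False
          using assms(1) that by (simp add: regular_def)
      qed
      moreover have "int p ^ a dvd U k n"
        using pa d by (metis dvd_trans int_dvd_int_iff of_nat_power)
      ultimately have "p ^ a dvd n"
        using prime_power_dvd_U_imp_dvd[OF p] by blast
      then show ?thesis
        using \<open>n \<noteq> 0\<close> p unfolding a_def
        by (metis multiplicity_geI not_prime_unit)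
    qed (simp add: a_def)
  qed
qed simp

lemma ramified_dvd_U:
  assumes "ramified k m"
  shows "int m dvd U k m"
  using assms
proof (induction m rule: prime_divisors_induct)
  case (factor p x)
  then have "int x dvd U k x" using ramified_dvd by (metis dvd_triv_right)
  moreover have "p dvd k * (k + 1)"
    using factor by (simp add: ramified_def)
  then have "int p * U k x dvd U k (p * x)"
    using factor.hyps prime_mult_U_dvd by blast
  ultimately show ?case
    by (metis dvd_trans mult_dvd_mono dvd_refl of_nat_mult)
qed (auto simp: ramified_def)

lemma int_eq_mod_9: "k mod 9 = r \<Longrightarrow> int k = 9 * int (k div 9) + int r"
  by (metis mult_div_mod_eq of_nat_add of_nat_mult of_nat_numeral)

lemma exceptional_9_dvd_U_3:
  assumes "exceptional k"
  shows "9 dvd U k 3"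
proof -
  have "U k 3 = (4 * int k + 1) * (4 * int k + 3)"
    by (simp add: numeral_3_eq_3 algebra_simps)
  moreover have "9 dvd 4 * int k + 1 \<or> 9 dvd 4 * int k + 3"
  proof -
    have "k mod 9 = 2 \<or> k mod 9 = 6" using assms by (simp add: exceptional_def cong_def)
    then have "4 * int k + 1 = 9 * (4 * int (k div 9) + 1)
        \<or> 4 * int k + 3 = 9 * (4 * int (k div 9) + 3)"
      using int_eq_mod_9[of k 2] int_eq_mod_9[of k 6] by auto
    then show ?thesis by (metis dvd_triv_left)
  qed
  ultimately show ?thesis by (metis dvd_mult dvd_mult2)
qed

section \<open>How indices grow when moduli are multiplied\<close>

text \<open>The index is multiplied by about \<open>p/2\<close> only; this gain over \<open>prime_mult_index\<close> requires that
\<open>p\<close> is a new prime factor.\<close>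
lemma unramified_mult_index:
  assumes p: "prime p" and nd: "\<not> p dvd k * (k + 1)" and "\<not> p dvd x"
    and x: "int x dvd U k n"
  shows "\<exists>t\<ge>1. t \<le> (p + 1) div 2 \<and> int (p * x) dvd U k (t * n)"
proof -
  obtain t where t: "t \<ge> 1" "t \<le> (p + 1) div 2" "int p dvd U k t"
    using prime_dvd_U_early[OF p nd] by blast
  have "coprime (int p) (int x)"
    using assms(3) p by (simp add: prime_imp_coprime)
  moreover have "int p dvd U k (t * n)"
    using t(3) U_dvd_U_mult[of k t n] by (metis dvd_trans mult.commute)
  moreover have "int x dvd U k (t * n)"
    using x U_dvd_U_mult dvd_trans by blast
  ultimately have "int (p * x) dvd U k (t * n)"
    by (simp add: divides_mult)
  then show ?thesis using t by blast
qed

text \<open>Either \<open>t = p\<close> works because \<open>p\<close> divides the quotient of \<open>U\<close> at \<open>p n\<close> and at \<open>n\<close>, or \<open>p\<close> is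
coprime to \<open>U\<^sub>n\<close> and an index at which \<open>p\<close> appears can be taken for \<open>t\<close>.\<close>
lemma prime_mult_index:
  assumes p: "prime p" and x: "int x dvd U k n"
  shows "\<exists>t\<ge>1. t \<le> p \<and> int (p * x) dvd U k (t * n)"
proof (cases "p dvd k * (k + 1) \<or> int p dvd U k n")
  case True
  have "int (p * x) dvd int p * U k n"
    using x by simp
  then have "int (p * x) dvd U k (p * n)"
    using prime_mult_U_dvd[OF p True] dvd_trans by blast
  then show ?thesis
    using prime_ge_1_nat[OF p] by blast
next
  case False
  then have "\<not> p dvd x"
    using x by (metis dvd_trans int_dvd_int_iff)
  then obtain t where t: "t \<ge> 1" "t \<le> (p + 1) div 2" "int (p * x) dvd U k (t * n)"
    using unramified_mult_index[OF p _ _ x] False by blast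
  moreover have "t \<le> p" using t(2) prime_ge_1_nat[OF p] by linarith
  ultimately show ?thesis by blast
qed

text \<open>In terms of indices of appearance: that of \<open>y x\<close> is at most \<open>y\<close> times that of \<open>x\<close>.\<close>
lemma mult_index:
  assumes "int x dvd U k n" "n \<ge> 1" "y > 0"
  shows "\<exists>N\<ge>1. N \<le> y * n \<and> int (y * x) dvd U k N"
  using assms(3)
proof (induction y rule: prime_divisors_induct)
  case (factor p y)
  then obtain N where N: "N \<ge> 1" "N \<le> y * n" "int (y * x) dvd U k N" by auto
  obtain t where t: "t \<ge> 1" "t \<le> p" "int (p * (y * x)) dvd U k (t * N)"
    using prime_mult_index[OF factor.hyps N(3)] by blast
  have "t * N \<le> p * (y * n)" using t(2) N(2) by (rule mult_le_mono)
  then show ?case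
    using t N(1) by (intro exI[of _ "t * N"]) (auto simp: mult.assoc)
qed (use assms in auto)

section \<open>Collisions modulo regular moduli\<close>

lemma coprime_int_natI:
  assumes "\<And>p. prime p \<Longrightarrow> p dvd m \<Longrightarrow> \<not> int p dvd x"
  shows "coprime (int m) x"
proof (rule ccontr)
  assume "\<not> coprime (int m) x"
  then have "nat (gcd (int m) x) \<noteq> 1"
    by (metis coprime_iff_gcd_eq_1 gcd_ge_0_int nat_eq_iff2 of_nat_1 int_nat_eq)
  then obtain p where p: "prime p" "p dvd nat (gcd (int m) x)"
    using prime_factor_nat by blast
  then have "int p dvd int (nat (gcd (int m) x))"
    by (simp only: int_dvd_int_iff)
  then have "int p dvd gcd (int m) x"
    by simp
  then show False using assms p(1) by auto
qed

text \<open>Modulo such a prime \<open>V\<^sub>n\<^sup>2 \<equiv> 4\<close>.\<close>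
lemma ramified_prime_dvd_V:
  assumes p: "prime p" and r: "p dvd k * (k + 1)" and v: "int p dvd V k n"
  shows "p = 2"
proof -
  have "int p dvd int (k * (k + 1))" using r int_dvd_int_iff by blast
  then have "int p dvd 16 * int k * (int k + 1) * (U k n)\<^sup>2"
    by (metis dvd_mult dvd_mult2 mult.assoc of_nat_1 of_nat_add of_nat_mult)
  moreover have "int p dvd (V k n)\<^sup>2" using v by (simp add: power2_eq_square)
  ultimately have "int p dvd 4"
    unfolding V_sq by (simp add: dvd_add_left_iff)
  then have "int p dvd int (2 ^ 2)" by simp
  then have "p dvd 2 ^ 2" by (simp only: int_dvd_int_iff)
  then show ?thesis
    using p prime_dvd_power primes_dvd_imp_eq two_is_prime_nat by blast
qed

text \<open>Since 2 divides \<open>m\<close>, the indices have the same parity, and in \<open>U\<^sub>i - U\<^sub>j = U\<^sub>e V\<^sub>j\<^sub>+\<^sub>e\<close> the second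
factor is twice a number coprime to \<open>m\<close>. So half of \<open>m\<close> divides \<open>e\<close>, which is half of \<open>i - j\<close>.\<close>
lemma even_regular_collision:
  assumes r: "regular k m" and "even m" and c: "int m dvd U k i - U k j" and "j \<le> i"
  shows "m dvd i - j"
proof -
  obtain m' where m': "m = 2 * m'" using \<open>even m\<close> by (rule evenE)
  have "even (U k i - U k j)" using c \<open>even m\<close> by (meson dvd_trans even_of_nat)
  then have "even (i - j)" using U_parity[of k i] U_parity[of k j] \<open>j \<le> i\<close> by auto
  then obtain e where e: "i = j + 2 * e"
    using \<open>j \<le> i\<close> by (metis evenE le_add_diff_inverse)
  define v where "v = 2 * (V k (j + e) div 4) + 1"
  have v: "V k (j + e) = 2 * v"
    unfolding v_def using V_mod_4[of k "j + e"] by presburger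
  have "coprime (int m') v"
  proof (rule coprime_int_natI)
    fix p assume p: "prime p" "p dvd m'"
    then have "p dvd k * (k + 1)"
      using r m' by (simp add: regular_def ramified_def)
    then have "int p dvd v \<Longrightarrow> p = 2"
      using ramified_prime_dvd_V[OF p(1), of k "j + e"] unfolding v by simp
    moreover have "odd v" unfolding v_def by simp
    ultimately show "\<not> int p dvd v" by auto
  qed
  moreover have "2 * int m' dvd 2 * (U k e * v)"
    using c unfolding e U_diff_even v m' by (simp add: ac_simps)
  then have "int m' dvd U k e * v" by simp
  ultimately have "int m' dvd U k e" by (simp add: coprime_dvd_mult_left_iff)
  then have "m' dvd e"
    using regular_dvd_U_imp_dvd regular_dvd[OF r] m' by (metis dvd_triv_right)
  then show ?thesis unfolding e m' by simp
qed

lemma U_Suc_minus_cong: "[U k (Suc n) - U k n = 1] (mod int k)"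
  using cong_diff[OF U_cong_index_mod_k[of k "Suc n"] U_cong_index_mod_k[of k n]] by simp

text \<open>When \<open>m\<close> is odd, \<open>i\<close> and \<open>j\<close> may differ in parity. This is where all primes of \<open>m\<close> must divide
\<open>k\<close>: the second factor in \<open>U_diff_odd\<close> is then congruent to 1 modulo each of them.\<close>
lemma odd_regular_collision:
  assumes r: "regular k m" and "odd m" and mk: "\<And>p. prime p \<Longrightarrow> p dvd m \<Longrightarrow> p dvd k"
    and c: "int m dvd U k i - U k j" and "j \<le> i"
  shows "m dvd i - j"
proof (cases "even (i - j)")
  case True
  then obtain e where e: "i = j + 2 * e"
    using \<open>j \<le> i\<close> by (metis evenE le_add_diff_inverse)
  have "coprime (int m) (V k (j + e))"
  proof (rule coprime_int_natI)
    fix p assume p: "prime p" "p dvd m"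
    then have "p dvd k * (k + 1)" using mk by simp
    moreover have "p \<noteq> 2" using p \<open>odd m\<close> by auto
    ultimately show "\<not> int p dvd V k (j + e)"
      using ramified_prime_dvd_V[OF p(1)] by blast
  qed
  then have "int m dvd U k e"
    using c unfolding e U_diff_even by (simp add: coprime_dvd_mult_left_iff)
  then have "m dvd e" using regular_dvd_U_imp_dvd[OF r] by blast
  then show ?thesis unfolding e by simp
next
  case False
  then obtain e where "i - j = 2 * e + 1" by (rule oddE)
  then have e: "i = Suc (j + 2 * e)" using \<open>j \<le> i\<close> by linarith
  have "coprime (int m) (U k (Suc (j + e)) - U k (j + e))"
  proof (rule coprime_int_natI)
    fix p assume p: "prime p" "p dvd m"
    then have "int p dvd int k" using mk by simp
    then have "[U k (Suc (j + e)) - U k (j + e) = 1] (mod int p)"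
      using U_Suc_minus_cong cong_dvd_modulus by blast
    then show "\<not> int p dvd U k (Suc (j + e)) - U k (j + e)"
      using cong_dvd_iff[of _ 1 "int p"] p(1) by (metis not_prime_unit prime_nat_int_transfer)
  qed
  then have "int m dvd U k (Suc e) + U k e"
    using c unfolding e U_diff_odd by (simp add: coprime_dvd_mult_left_iff)
  then have "int m dvd U k (Suc (2 * e))"
    unfolding U_odd_factor by simp
  then show ?thesis
    using regular_dvd_U_imp_dvd[OF r] unfolding e by simp
qed

section \<open>Early collisions modulo odd ramified moduli\<close>

text \<open>Modulo \<open>k + 1\<close> consecutive terms \<open>\<plusminus>n\<close> and \<open>\<mp>(n + 1)\<close> have opposite signs and almost cancel.\<close>
lemma U_Suc_plus_prime_k1:
  assumes "prime p" "int p dvd int k + 1"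
  shows "\<not> int p dvd U k (Suc n) + U k n"
proof -
  have "[U k (Suc n) + U k n = (-1) ^ Suc (Suc n) * int (Suc n) + (-1) ^ Suc n * int n] (mod int p)"
    using U_cong_index_mod_k1 assms(2) by (meson cong_add cong_dvd_modulus)
  then have "[U k (Suc n) + U k n = (-1) ^ n] (mod int p)"
    by (simp add: algebra_simps)
  then have "int p dvd U k (Suc n) + U k n \<longleftrightarrow> int p dvd (-1) ^ n"
    by (rule cong_dvd_iff)
  then show ?thesis
    using assms(1) by (metis dvd_minus_iff minus_one_power_iff not_prime_unit prime_nat_int_transfer)
qed

lemma ramified_split:
  assumes "ramified k m"
  shows "\<exists>P Q. m = P * Q \<and> (\<forall>p. prime p \<longrightarrow> p dvd P \<longrightarrow> p dvd k + 1)
    \<and> (\<forall>p. prime p \<longrightarrow> p dvd Q \<longrightarrow> p dvd k)"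
  using assms
proof (induction m rule: prime_divisors_induct)
  case (factor q x)
  then obtain P Q where PQ: "x = P * Q" "\<forall>p. prime p \<longrightarrow> p dvd P \<longrightarrow> p dvd k + 1"
    "\<forall>p. prime p \<longrightarrow> p dvd Q \<longrightarrow> p dvd k"
    using ramified_dvd by (metis dvd_triv_right)
  have "q dvd k * (k + 1)" using factor by (simp add: ramified_def)
  then have "q dvd k \<or> q dvd k + 1" using factor.hyps prime_dvd_mult_iff by blast
  then show ?case
  proof
    assume q: "q dvd k"
    have "\<forall>p. prime p \<longrightarrow> p dvd q * Q \<longrightarrow> p dvd k"
      using q PQ(3) factor.hyps by (metis prime_dvd_mult_iff dvd_trans)
    then show ?thesis using PQ by (intro exI[of _ P] exI[of _ "q * Q"]) auto
  next
    assume q: "q dvd k + 1"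
    have "\<forall>p. prime p \<longrightarrow> p dvd q * P \<longrightarrow> p dvd k + 1"
      using q PQ(2) factor.hyps by (metis prime_dvd_mult_iff dvd_trans)
    then show ?thesis using PQ by (intro exI[of _ "q * P"] exI[of _ Q]) auto
  qed
qed (auto simp: ramified_def)

text \<open>\<open>Q\<close> divides \<open>U\<^sub>Q = (U\<^sub>e\<^sub>+\<^sub>1 + U\<^sub>e)(U\<^sub>e\<^sub>+\<^sub>1 - U\<^sub>e)\<close>, and the second factor is 1 modulo \<open>k\<close>.\<close>
lemma odd_half_index_plus:
  assumes "\<And>p. prime p \<Longrightarrow> p dvd Q \<Longrightarrow> p dvd k" and "Q > 0" and e: "Q = 2 * e + 1"
  shows "int Q dvd U k (Suc e) + U k e"
proof -
  have "ramified k Q" using assms by (auto simp: ramified_def)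
  then have "int Q dvd (U k (Suc e) + U k e) * (U k (Suc e) - U k e)"
    using ramified_dvd_U[of k Q] unfolding U_odd_factor[symmetric] by (simp add: e)
  moreover have "coprime (int Q) (U k (Suc e) - U k e)"
  proof (rule coprime_int_natI)
    fix p assume p: "prime p" "p dvd Q"
    then have "int p dvd int k" using assms(1) by simp
    then have "[U k (Suc e) - U k e = 1] (mod int p)"
      using U_Suc_minus_cong cong_dvd_modulus by blast
    then show "\<not> int p dvd U k (Suc e) - U k e"
      using cong_dvd_iff[of _ 1 "int p"] p(1) by (metis not_prime_unit prime_nat_int_transfer)
  qed
  ultimately show ?thesis by (simp add: coprime_dvd_mult_left_iff)
qed

text \<open>The counterpart for prime factors of \<open>k + 1\<close>: now the other factor is a unit.\<close>
lemma odd_half_index_minus: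
  assumes "\<And>p. prime p \<Longrightarrow> p dvd P \<Longrightarrow> p dvd k + 1" and "P > 0" and "P dvd 2 * f + 1"
  shows "int P dvd U k (Suc f) - U k f"
proof -
  have "ramified k P" using assms(1,2) unfolding ramified_def by (metis dvd_mult)
  then have "int P dvd U k P" by (rule ramified_dvd_U)
  also have "U k P dvd U k (2 * f + 1)"
    using assms(3) U_dvd_U_mult by (metis dvd_div_mult_self)
  finally have "int P dvd (U k (Suc f) + U k f) * (U k (Suc f) - U k f)"
    unfolding U_odd_factor[symmetric] by simp
  moreover have "coprime (int P) (U k (Suc f) + U k f)"
  proof (rule coprime_int_natI)
    fix p assume p: "prime p" "p dvd P"
    then have "int p dvd int (k + 1)" using assms(1) int_dvd_int_iff by blast
    then show "\<not> int p dvd U k (Suc f) + U k f"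
      using U_Suc_plus_prime_k1[OF p(1)] by (simp add: add.commute)
  qed
  ultimately show ?thesis by (simp add: coprime_dvd_mult_right_iff)
qed

lemma odd_multiple_in_window:
  fixes P Q :: nat
  assumes "odd P" "odd Q" "P < Q" "P > 0"
  shows "\<exists>s. odd s \<and> P dvd s \<and> Q \<le> s \<and> s < Q + 2 * P"
proof -
  define c where "c = (Q + P - 1) div (2 * P)"
  have "2 * P * c + (Q + P - 1) mod (2 * P) = Q + P - 1"
    unfolding c_def by (rule mult_div_mod_eq)
  moreover have "(Q + P - 1) mod (2 * P) < 2 * P" using assms by simp
  moreover have "P * (2 * c + 1) = 2 * P * c + P" by (simp add: algebra_simps)
  ultimately have "Q \<le> P * (2 * c + 1)" "P * (2 * c + 1) < Q + 2 * P" using assms by linarith+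
  then show ?thesis using assms(1) by (intro exI[of _ "P * (2 * c + 1)"]) auto
qed

text \<open>Write \<open>m = P Q\<close> where the primes of \<open>P\<close> divide \<open>k + 1\<close> and those of \<open>Q\<close> divide \<open>k\<close>. If \<open>i - j = Q\<close> and
\<open>i + j = s\<close> is an odd multiple of \<open>P\<close>, the two factors of \<open>U\<^sub>i - U\<^sub>j\<close> are divisible by \<open>Q\<close> and
\<open>P\<close>. Nonnegativity of \<open>j\<close> requires \<open>s \<ge> Q\<close>, and the bound on \<open>i = (s + Q)/2\<close> holds for the
least such \<open>s\<close> because \<open>P\<close> is at least 3.\<close>
lemma odd_ramified_early_collision:
  assumes r: "ramified k m" and "odd m" and q: "prime q" "q dvd m" "\<not> q dvd k"
  shows "\<exists>i j. j < i \<and> 2 * i \<le> m + 1 \<and> int m dvd U k i - U k j"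
proof -
  obtain P Q where PQ: "m = P * Q" "\<And>p. prime p \<Longrightarrow> p dvd P \<Longrightarrow> p dvd k + 1"
    "\<And>p. prime p \<Longrightarrow> p dvd Q \<Longrightarrow> p dvd k"
    using ramified_split[OF r] by blast
  have pos: "P > 0" "Q > 0" and od: "odd P" "odd Q"
    using r \<open>odd m\<close> PQ(1) by (auto simp: ramified_def)
  have "P \<noteq> 1" using PQ q by auto
  then have P3: "P \<ge> 3" using od(1) pos by presburger
  obtain s where s: "odd s" "P dvd s" "Q \<le> s" "s + Q \<le> m + 1"
  proof (cases "Q \<le> P")
    case True
    have "P + Q \<le> P * Q + 1"
    proof -
      obtain a b where "P = Suc a" "Q = Suc b" using pos by (metis Suc_pred)
      then show ?thesis by simp
    qed
    then show ?thesis using True od PQ(1) that[of P] by simp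
  next
    case False
    then obtain s where s: "odd s" "P dvd s" "Q \<le> s" "s < Q + 2 * P"
      using odd_multiple_in_window[OF od] pos by auto
    have "Q \<ge> 3" using False P3 by simp
    obtain a b where ab: "P = a + 3" "Q = b + 3" using P3 \<open>Q \<ge> 3\<close> by (metis le_add_diff_inverse2)
    \<comment> \<open>the window only gives \<open>s + Q \<le> m + 2\<close>; parity saves the last unit\<close>
    have "even (s + Q)" using s(1) od by simp
    moreover have "s + Q \<le> m + 2" using s(4) unfolding PQ(1) ab by (simp add: algebra_simps)
    moreover have "odd (m + 2)" using \<open>odd m\<close> by simp
    ultimately have "s + Q \<le> m + 1" by (metis le_SucE add_2_eq_Suc' Suc_eq_plus1)
    then show ?thesis using s that by blast
  qed
  obtain e where e: "Q = 2 * e + 1" using od by (auto elim: oddE)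
  obtain f where f: "s = 2 * f + 1" using s(1) by (rule oddE)
  have "e \<le> f" using s(3) e f by simp
  define j where "j = f - e"
  have jf: "j + e = f" using \<open>e \<le> f\<close> by (simp add: j_def)
  have "int Q dvd U k (Suc e) + U k e"
    using odd_half_index_plus[of Q k e] PQ(3) pos(2) e by blast
  moreover have "int P dvd U k (Suc f) - U k f"
    using odd_half_index_minus[of P k f] PQ(2) pos(1) s(2) f by blast
  ultimately have "int m dvd U k (Suc (j + 2 * e)) - U k j"
    unfolding U_diff_odd jf PQ(1) of_nat_mult by (metis mult.commute mult_dvd_mono)
  moreover have "2 * Suc (j + 2 * e) \<le> m + 1"
    using s(4) e f jf by simp
  ultimately show ?thesis by (intro exI[of _ "Suc (j + 2 * e)"] exI[of _ j]) auto
qed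

section \<open>The discriminator\<close>

definition discriminates :: "nat \<Rightarrow> nat \<Rightarrow> nat \<Rightarrow> bool" where
  "discriminates k n m \<longleftrightarrow> (\<forall>i<n. \<forall>j<n. i \<noteq> j \<longrightarrow> \<not> [U k i = U k j] (mod int m))"

lemma discriminator_alt: "discriminator k n = (LEAST m. m \<ge> 1 \<and> discriminates k n m)"
  by (simp add: discriminator_def discriminates_def)

lemma discriminator_le: "m \<ge> 1 \<Longrightarrow> discriminates k n m \<Longrightarrow> discriminator k n \<le> m"
  unfolding discriminator_alt by (rule Least_le) simp

text \<open>The definition excludes multiples of 9 only for \<open>k \<equiv> 6\<close> modulo 9; when \<open>k \<equiv> 2\<close>, the prime 3 does
not divide \<open>k\<close> and hence not \<open>m\<close>.\<close>
lemma A_set_iff: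
  "m \<in> A_set k \<longleftrightarrow> odd m \<and> regular k m \<and> (\<forall>p. prime p \<longrightarrow> p dvd m \<longrightarrow> p dvd k)"
proof -
  have "\<not> 9 dvd m" if m: "\<forall>p. prime p \<longrightarrow> p dvd m \<longrightarrow> p dvd k" and k2: "[k = 2] (mod 9)"
  proof
    assume "9 dvd m"
    then have "3 dvd m" by (rule dvd_trans[rotated]) simp
    then have "3 dvd k" using m by simp
    then show False using k2 unfolding cong_def by presburger
  qed
  then show ?thesis
    by (auto simp: A_set_def regular_def ramified_def exceptional_def odd_pos)
qed

lemma B_set_iff: "m \<in> B_set k \<longleftrightarrow> even m \<and> regular k m"
  by (auto simp: B_set_def regular_def ramified_def exceptional_def)

lemma power2_in_B_set: "e \<ge> 1 \<Longrightarrow> 2 ^ e \<in> B_set k"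
proof -
  assume e: "e \<ge> 1"
  have "p dvd k * (k + 1)" if "prime p" "p dvd 2 ^ e" for p
  proof -
    have "p = 2" using that by (metis prime_dvd_power primes_dvd_imp_eq two_is_prime_nat)
    then show ?thesis by simp
  qed
  moreover have "\<not> 9 dvd (2::nat) ^ e"
  proof
    assume "9 dvd (2::nat) ^ e"
    then have "(3::nat) dvd 2 ^ e" by (rule dvd_trans[rotated]) simp
    then have "(3::nat) dvd 2" by (rule prime_dvd_power[rotated]) simp
    then show False by simp
  qed
  ultimately show ?thesis
    using e by (simp add: B_set_iff regular_def ramified_def)
qed

text \<open>Applied to \<open>n\<close> itself it bounds the discriminator; applied to \<open>(p + 1)/2\<close> for an odd prime
\<open>p\<close> it provides the power of 2 that replaces \<open>p\<close>.\<close>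
lemma power2_between:
  assumes "n \<ge> (2::nat)"
  shows "\<exists>e\<ge>1. n \<le> 2 ^ e \<and> 2 ^ e < 2 * n"
proof -
  obtain e where "2 ^ e < n" "n \<le> 2 ^ (e + 1)"
    using ex_power_ivl2[of 2 n] assms by auto
  then show ?thesis by (intro exI[of _ "Suc e"]) auto
qed

lemma discriminates_AB:
  assumes m: "m \<in> A_set k \<union> B_set k" and "n \<le> m"
  shows "discriminates k n m"
proof -
  have *: "m dvd i - j" if "int m dvd U k i - U k j" "j \<le> i" for i j
    using m
  proof
    assume "m \<in> A_set k"
    then show ?thesis using odd_regular_collision[of k m i j] that by (auto simp: A_set_iff)
  next
    assume "m \<in> B_set k"
    then show ?thesis using even_regular_collision[of k m i j] that by (auto simp: B_set_iff)
  qed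
  have "i = j" if ij: "i < n" "j < n" "[U k i = U k j] (mod int m)" for i j
  proof (rule ccontr)
    assume "i \<noteq> j"
    then consider "i < j" | "j < i" by linarith
    then show False
    proof cases
      case 1
      have "int m dvd U k j - U k i" using ij(3) cong_iff_dvd_diff cong_sym by blast
      then have "m dvd j - i" using *[of j i] 1 by simp
      then show False using 1 ij \<open>n \<le> m\<close> by (auto dest: dvd_imp_le)
    next
      case 2
      then have "m dvd i - j" using *[of i j] ij(3) by (simp add: cong_iff_dvd_diff)
      then show False using 2 ij \<open>n \<le> m\<close> by (auto dest: dvd_imp_le)
    qed
  qed
  then show ?thesis unfolding discriminates_def by blast
qed

lemma discriminator_le_AB:
  assumes "m \<in> A_set k \<union> B_set k" "n \<le> m"
  shows "discriminator k n \<le> m"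
proof -
  have "m > 0" using assms(1) by (auto simp: A_set_iff B_set_iff regular_def ramified_def)
  then show ?thesis using discriminator_le discriminates_AB[OF assms] by simp
qed

lemma discriminator_discriminates:
  "discriminator k n \<ge> 1" "discriminates k n (discriminator k n)"
proof -
  have "n \<le> 2 ^ Suc n" by (rule less_imp_le, rule less_trans[OF less_exp]) simp
  then have "discriminates k n (2 ^ Suc n)"
    using discriminates_AB[of "2 ^ Suc n" k n] power2_in_B_set[of "Suc n" k] by simp
  then have "1 \<le> (2::nat) ^ Suc n \<and> discriminates k n (2 ^ Suc n)" by simp
  then have "1 \<le> discriminator k n \<and> discriminates k n (discriminator k n)"
    unfolding discriminator_alt by (rule LeastI)
  then show "discriminator k n \<ge> 1" "discriminates k n (discriminator k n)" by auto
qed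

text \<open>\<open>U\<^sub>0 = 0\<close> and \<open>U\<^sub>N\<close> collide modulo \<open>m\<close>.\<close>
lemma discriminates_le_index:
  assumes "discriminates k n m" "N \<ge> 1" "int m dvd U k N"
  shows "n \<le> N"
proof (rule ccontr)
  assume "\<not> n \<le> N"
  then have "\<not> [U k N = U k 0] (mod int m)"
    using assms(1,2) unfolding discriminates_def by (metis less_trans not_less not_one_le_zero linorder_neqE_nat)
  then show False using assms(3) by (simp add: cong_0_iff)
qed

lemma discriminator_ge: "n \<le> discriminator k n"
proof -
  obtain N where N: "N \<ge> 1" "N \<le> discriminator k n" "int (discriminator k n) dvd U k N"
    using mult_index[of 1 k 1 "discriminator k n"] discriminator_discriminates(1)[of k n] by auto
  show ?thesis
    using discriminates_le_index[OF discriminator_discriminates(2) N(1,3)] N(2) by (rule le_trans)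
qed

lemma discriminator_lt_double:
  assumes "n \<ge> 1"
  shows "discriminator k n < 2 * n"
proof (cases "n = 1")
  case True
  then have "discriminates k n 1" by (simp add: discriminates_def)
  then show ?thesis using discriminator_le[of 1 k n] True by simp
next
  case False
  then obtain e where "e \<ge> 1" "n \<le> 2 ^ e" "2 ^ e < 2 * n"
    using power2_between[of n] assms by auto
  then show ?thesis
    using discriminator_le_AB[of "2 ^ e" k n] power2_in_B_set[of e k] by auto
qed

section \<open>The values of the discriminator outside the two sets\<close>

text \<open>Otherwise the index of appearance is at most a third of the modulus, which is incompatible with
\<open>discriminator_lt_double\<close>.\<close>
lemma exceptional_no_9:
  assumes "n \<ge> 1" "exceptional k"
  shows "\<not> 9 dvd discriminator k n"
proof
  assume "9 dvd discriminator k n"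
  then obtain y where y: "discriminator k n = y * 9" by (metis dvdE mult.commute)
  have "y > 0" using discriminator_discriminates(1)[of k n] y by simp
  moreover have "int 9 dvd U k 3" using exceptional_9_dvd_U_3[OF assms(2)] by simp
  ultimately obtain N where N: "N \<ge> 1" "N \<le> y * 3" "int (y * 9) dvd U k N"
    using mult_index[of 9 k 3 y] by auto
  have "n \<le> y * 3"
    using discriminates_le_index[OF discriminator_discriminates(2) N(1)] N y by (metis le_trans)
  then show False using discriminator_lt_double[OF assms(1), of k] y by linarith
qed

text \<open>If the discriminator \<open>m\<close> had a prime factor not dividing \<open>k\<close>, the early collision would give
\<open>2n \<le> m + 1\<close>. A power of 2 in \<open>[n, 2n)\<close> then lies in \<open>[n, m]\<close> and discriminates, so it equals \<open>m\<close>; but \<open>m\<close>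
is odd.\<close>
lemma discriminator_odd_ramified:
  assumes "n \<ge> 1" "odd (discriminator k n)" "ramified k (discriminator k n)" "prime p" "p dvd discriminator k n"
  shows "p dvd k"
proof (rule ccontr)
  assume "\<not> p dvd k"
  define m where "m = discriminator k n"
  obtain i j where ij: "j < i" "2 * i \<le> m + 1" "int m dvd U k i - U k j"
    using odd_ramified_early_collision[of k m p] assms \<open>\<not> p dvd k\<close> unfolding m_def by blast
  have "n \<le> i"
  proof (rule ccontr)
    assume "\<not> n \<le> i"
    then have "\<not> [U k i = U k j] (mod int m)"
      using discriminator_discriminates(2)[of k n] ij(1) unfolding m_def discriminates_def by simp
    then show False using ij(3) by (simp add: cong_iff_dvd_diff)
  qed
  then have "2 * n \<le> m + 1" using ij(2) by simp
  have "m \<noteq> 1" using assms(4,5) m_def by (metis nat_dvd_1_iff_1 not_prime_1)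
  then have "n \<ge> 2"
    using discriminator_lt_double[OF assms(1), of k] discriminator_discriminates(1)[of k n]
    unfolding m_def by linarith
  then obtain e where e: "e \<ge> 1" "n \<le> 2 ^ e" "2 ^ e < 2 * n" using power2_between by blast
  have "m \<le> 2 ^ e"
    using discriminator_le_AB[of "2 ^ e" k n] power2_in_B_set[OF e(1)] e(2) unfolding m_def by blast
  then have "m = 2 ^ e" using e(3) \<open>2 * n \<le> m + 1\<close> by linarith
  then show False using assms(2) e(1) m_def by simp
qed

text \<open>Here \<open>b\<close> arises from \<open>m\<close> by replacing each unramified prime \<open>p\<close> by a power of 2 in \<open>[(p + 1)/2, p)\<close>.
Each of them multiplies the index by at most \<open>(p + 1)/2\<close>, so \<open>b\<close> still bounds the index.\<close>
lemma squarefree_unramified_index: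
  assumes "m > 0" and "\<And>p. prime p \<Longrightarrow> \<not> p dvd k * (k + 1) \<Longrightarrow> \<not> p\<^sup>2 dvd m"
  shows "\<exists>N b. N \<ge> 1 \<and> int m dvd U k N \<and> N \<le> b \<and> b \<le> m \<and> ramified k b
    \<and> (9 dvd b \<longrightarrow> 9 dvd m) \<and> (b = m \<or> even b)"
  using assms
proof (induction m rule: less_induct)
  case (less m)
  show ?case
  proof (cases "ramified k m")
    case True
    then have "int m dvd U k m" by (rule ramified_dvd_U)
    then show ?thesis using True less.prems(1) by (intro exI[of _ m]) auto
  next
    case False
    then obtain p where p: "prime p" "p dvd m" "\<not> p dvd k * (k + 1)"
      using less.prems(1) by (auto simp: ramified_def)
    obtain x where x: "m = p * x" using p(2) by (rule dvdE)
    have px: "\<not> p dvd x"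
      using less.prems(2)[OF p(1,3)] unfolding x power2_eq_square by (meson dvd_refl mult_dvd_mono)
    have "odd p" and p3: "p \<ge> 3" using unramified_odd[OF p(1,3)] by auto
    have x0: "x > 0" using less.prems(1) x by simp
    have "x < m" using x p3 x0 by simp
    moreover have "\<not> q\<^sup>2 dvd x" if "prime q" "\<not> q dvd k * (k + 1)" for q
      using less.prems(2)[OF that] x by auto
    ultimately obtain N b where N: "N \<ge> 1" "int x dvd U k N" "N \<le> b" "b \<le> x" "ramified k b"
      "9 dvd b \<longrightarrow> 9 dvd x"
      using less.IH[of x] x0 by blast
    obtain t where t: "t \<ge> 1" "t \<le> (p + 1) div 2" "int (p * x) dvd U k (t * N)"
      using unramified_mult_index[OF p(1,3) px N(2)] by blast
    obtain e where e: "e \<ge> 1" "(p + 1) div 2 \<le> 2 ^ e" "2 ^ e < 2 * ((p + 1) div 2)"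
    proof -
      have "(p + 1) div 2 \<ge> 2" using p3 by presburger
      then show thesis using power2_between that by blast
    qed
    have "2 * ((p + 1) div 2) = p + 1" using \<open>odd p\<close> by presburger
    then have "2 ^ e \<le> p" using e(3) by simp
    have "ramified k (2 ^ e * b)"
      using ramified_mult N(5) power2_in_B_set[OF e(1), of k] by (simp add: B_set_iff regular_def)
    moreover have "t * N \<le> 2 ^ e * b" using t(2) e(2) N(3) by (intro mult_le_mono) auto
    moreover have "2 ^ e * b \<le> m" unfolding x using \<open>2 ^ e \<le> p\<close> N(4) by (rule mult_le_mono)
    moreover have "9 dvd 2 ^ e * b \<longrightarrow> 9 dvd m"
    proof
      assume "9 dvd 2 ^ e * b"
      moreover have "coprime (9::nat) (2 ^ e)" by (simp add: coprime_right_2_iff_odd)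
      ultimately have "9 dvd b" by (simp add: coprime_dvd_mult_right_iff)
      then show "9 dvd m" using N(6) x by auto
    qed
    moreover have "even (2 ^ e * b)" using e(1) by simp
    moreover have "t * N \<ge> 1" using t(1) N(1) by simp
    ultimately show ?thesis
      using t(3) unfolding x[symmetric] by (intro exI[of _ "t * N"] exI[of _ "2 ^ e * b"]) blast
  qed
qed

text \<open>If no such square divides the discriminator \<open>m\<close>, the number \<open>b\<close> of
\<open>squarefree_unramified_index\<close> belongs to one of the two sets and satisfies \<open>n \<le> b \<le> m\<close>. By
minimality \<open>b = m\<close>.\<close>
lemma discriminator_AB_or_square:
  assumes "n \<ge> 1" and nAB: "discriminator k n \<notin> A_set k \<union> B_set k"
  shows "\<exists>p. prime p \<and> \<not> p dvd k * (k + 1) \<and> p\<^sup>2 dvd discriminator k n"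
proof (rule ccontr)
  assume neg: "\<not> ?thesis"
  define m where "m = discriminator k n"
  have m0: "m > 0" using discriminator_discriminates(1)[of k n] unfolding m_def by simp
  obtain N b where N: "N \<ge> 1" "int m dvd U k N" "N \<le> b" "b \<le> m" "ramified k b"
    "9 dvd b \<longrightarrow> 9 dvd m" "b = m \<or> even b"
    using squarefree_unramified_index[of m k] m0 neg unfolding m_def by blast
  have "regular k b"
    using N(5,6) exceptional_no_9[OF assms(1)] unfolding m_def regular_def by blast
  have "n \<le> b"
    using discriminates_le_index[OF discriminator_discriminates(2) N(1)] N(2,3) unfolding m_def
    by (meson le_trans)
  have "b \<in> A_set k \<union> B_set k"
  proof (cases "even b")
    case True
    then show ?thesis using \<open>regular k b\<close> by (simp add: B_set_iff)
  next
    case False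
    then have "b = m" using N(7) by simp
    then show ?thesis
      using False \<open>regular k b\<close> discriminator_odd_ramified[OF assms(1), of k] N(5)
      unfolding Un_iff A_set_iff m_def by blast
  qed
  then have "m \<le> b" using discriminator_le_AB \<open>n \<le> b\<close> unfolding m_def by blast
  then have "b = m" using N(4) by simp
  then show False using nAB \<open>b \<in> _\<close> unfolding m_def by simp
qed

section \<open>Indices of appearance of squares of primes\<close>

lemma index_of_appearance_le: "N \<ge> 1 \<Longrightarrow> int m dvd U k N \<Longrightarrow> index_of_appearance k m \<le> N"
  unfolding index_of_appearance_def by (rule Least_le) simp

lemma index_of_appearance_dvd:
  assumes "m > 0"
  shows "index_of_appearance k m \<ge> 1" "int m dvd U k (index_of_appearance k m)"
proof -
  obtain N where "N \<ge> 1" "int m dvd U k N"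
    using mult_index[of 1 k 1 m] assms by auto
  then have "N \<ge> 1 \<and> int m dvd U k N" by simp
  then have "index_of_appearance k m \<ge> 1 \<and> int m dvd U k (index_of_appearance k m)"
    unfolding index_of_appearance_def by (rule LeastI)
  then show "index_of_appearance k m \<ge> 1" "int m dvd U k (index_of_appearance k m)" by auto
qed

lemma regular_index_of_appearance:
  assumes "regular k m"
  shows "m \<le> index_of_appearance k m"
proof -
  have "m > 0" using assms by (simp add: regular_def ramified_def)
  then have "m dvd index_of_appearance k m" "index_of_appearance k m > 0"
    using regular_dvd_U_imp_dvd[OF assms] index_of_appearance_dvd[of m k] by simp_all
  then show ?thesis by (rule dvd_imp_le)
qed

text \<open>Applied to \<open>p\<^sup>2\<close> and \<open>2p\<^sup>2\<close>, whose ratios enter the definitions of the two suprema.\<close>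
lemma discriminator_le_index_ratio:
  assumes "d dvd discriminator k n"
  shows "real n \<le> real (index_of_appearance k d) / real d * real (discriminator k n)"
proof -
  obtain y where y: "discriminator k n = y * d" using assms by (metis dvdE mult.commute)
  have "y > 0" "d > 0" using discriminator_discriminates(1)[of k n] y by (auto intro: gr0I)
  then obtain N where N: "N \<ge> 1" "N \<le> y * index_of_appearance k d" "int (y * d) dvd U k N"
    using mult_index[OF index_of_appearance_dvd(2,1)] by blast
  have "n \<le> y * index_of_appearance k d"
    using discriminates_le_index[OF discriminator_discriminates(2) N(1)] N y by (metis le_trans)
  then have "real n \<le> real y * real (index_of_appearance k d)"
    by (metis of_nat_le_iff of_nat_mult)
  then show ?thesis using \<open>d > 0\<close> unfolding y by (simp add: field_simps)
qed

lemma prime_sq_dvd_U: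
  assumes "prime p" "int p dvd U k t"
  shows "int (p\<^sup>2) dvd U k (p * t)"
proof -
  have "int p * int p dvd int p * U k t" using assms(2) by simp
  then show ?thesis
    using prime_mult_U_dvd[of p k t] assms by (auto simp: power2_eq_square intro: dvd_trans)
qed

lemma unramified_index_sq:
  assumes p: "prime p" "\<not> p dvd k * (k + 1)"
  shows "2 * index_of_appearance k (p\<^sup>2) \<le> p * (p + 1)"
proof -
  obtain t where t: "t \<ge> 1" "t \<le> (p + 1) div 2" "int p dvd U k t"
    using prime_dvd_U_early[OF p] by blast
  have "index_of_appearance k (p\<^sup>2) \<le> p * t"
    using prime_sq_dvd_U[OF p(1) t(3)] t(1) prime_gt_0_nat[OF p(1)] by (intro index_of_appearance_le) auto
  moreover have "p * (2 * t) \<le> p * (p + 1)" using t(2) by (intro mult_le_mono) auto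
  ultimately show ?thesis by linarith
qed

lemma even_index_sq:
  assumes p: "prime p" "odd p" "int p dvd U k t" "t \<ge> 1"
  shows "index_of_appearance k (2 * p\<^sup>2) \<le> 2 * p * t"
    and "even t \<Longrightarrow> index_of_appearance k (2 * p\<^sup>2) \<le> p * t"
proof -
  have co: "coprime (int 2) (int (p\<^sup>2))"
    using p(2) by (simp add: coprime_left_2_iff_odd)
  have *: "index_of_appearance k (2 * p\<^sup>2) \<le> N"
    if "even N" "N \<ge> 1" "int (p\<^sup>2) dvd U k N" for N
  proof -
    have "int 2 dvd U k N" using that(1) U_parity by simp
    then have "int (2 * p\<^sup>2) dvd U k N"
      using divides_mult[OF _ that(3) co] by (metis of_nat_mult)
    then show ?thesis using that(2) by (intro index_of_appearance_le)
  qed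
  have sq: "int (p\<^sup>2) dvd U k (p * t)" using prime_sq_dvd_U[OF p(1,3)] .
  have p0: "p > 0" using p(1) prime_gt_0_nat by blast
  show "index_of_appearance k (2 * p\<^sup>2) \<le> p * t" if "even t"
    using *[OF _ _ sq] that p0 p(4) by simp
  have "int (p\<^sup>2) dvd U k (2 * (p * t))" using sq U_dvd_U_mult dvd_trans by blast
  then show "index_of_appearance k (2 * p\<^sup>2) \<le> 2 * p * t"
    using *[of "2 * (p * t)"] p0 p(4) by (simp add: mult.assoc)
qed

lemma prime_9_dvd_sq:
  fixes p :: nat
  assumes "prime p" "9 dvd 2 * p\<^sup>2"
  shows "p = 3"
proof -
  have "3 dvd 2 * p\<^sup>2" using assms(2) by (rule dvd_trans[rotated]) simp
  then have "3 dvd (2::nat) \<or> 3 dvd p\<^sup>2"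
    using prime_dvd_mult_iff[of "3::nat" 2 "p\<^sup>2"] by simp
  then have "3 dvd p" using prime_dvd_power[of "3::nat" p 2] by auto
  then show ?thesis using primes_dvd_imp_eq[of 3 p] assms(1) by simp
qed

lemma ramified_double_sq:
  assumes "prime p" "p dvd k * (k + 1)"
  shows "ramified k (2 * p\<^sup>2)"
proof -
  have "q dvd k * (k + 1)" if q: "prime q" "q dvd 2 * p\<^sup>2" for q
  proof -
    have "q dvd 2 \<or> q dvd p" using q by (metis prime_dvd_mult_iff prime_dvd_power)
    then have "q = 2 \<or> q = p" using q(1) assms(1) primes_dvd_imp_eq two_is_prime_nat by blast
    then show ?thesis using assms(2) by auto
  qed
  then show ?thesis using assms(1) by (auto simp: ramified_def prime_gt_0_nat)
qed

text \<open>So among ramified primes only 3 can contribute to the two suprema, and only for exceptional \<open>k\<close>.\<close>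
lemma ramified_early_sq:
  assumes "prime p" "p dvd k * (k + 1)" "d dvd 2 * p\<^sup>2" "index_of_appearance k d < d"
  shows "p = 3 \<and> exceptional k"
proof -
  have "\<not> regular k d" using regular_index_of_appearance[of k d] assms(4) by linarith
  then have "9 dvd d" "exceptional k"
    using ramified_dvd[OF ramified_double_sq[OF assms(1,2)] assms(3)] by (auto simp: regular_def)
  then show ?thesis using prime_9_dvd_sq[OF assms(1)] assms(3) dvd_trans by blast
qed

text \<open>For unramified \<open>p\<close> the ratio is at most \<open>(p + 1)/(2p)\<close>, that is, 2/3 for \<open>p = 3\<close> and at most 3/5 for
\<open>p \<ge> 5\<close>. The prime 3 is unramified only if \<open>k \<equiv> 1\<close> modulo 3; the residue 4 modulo 9 is harmless since then 9
divides \<open>U\<^sub>2\<close>.\<close>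
lemma index_sq_bounds:
  assumes p: "prime p" and lt: "index_of_appearance k (p\<^sup>2) < p\<^sup>2"
  shows "3 * index_of_appearance k (p\<^sup>2) \<le> 2 * p\<^sup>2"
    and "\<not> ([k = 1] (mod 9) \<or> [k = 7] (mod 9)) \<Longrightarrow> 5 * index_of_appearance k (p\<^sup>2) \<le> 3 * p\<^sup>2"
proof -
  let ?z = "index_of_appearance k (p\<^sup>2)"
  have "3 * ?z \<le> 2 * p\<^sup>2 \<and>
    (\<not> ([k = 1] (mod 9) \<or> [k = 7] (mod 9)) \<longrightarrow> 5 * ?z \<le> 3 * p\<^sup>2)"
  proof (cases "p dvd k * (k + 1)")
    case True
    then have *: "p = 3" "exceptional k" using ramified_early_sq[OF p _ _ lt] by auto
    have "?z \<le> 3" using exceptional_9_dvd_U_3[OF *(2)] *(1) by (intro index_of_appearance_le) auto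
    then show ?thesis using *(1) by simp
  next
    case False
    have z: "2 * ?z \<le> p\<^sup>2 + p"
      using unramified_index_sq[OF p False] by (simp add: power2_eq_square)
    have p3: "odd p" "p \<ge> 3" using unramified_odd[OF p False] by auto
    have "3 * p \<le> p\<^sup>2" using p3(2) by (simp add: power2_eq_square)
    then have 1: "3 * ?z \<le> 2 * p\<^sup>2" using z by linarith
    show ?thesis
    proof (cases "p = 3")
      case True
      then have "\<not> 3 dvd k" "\<not> 3 dvd k + 1" using False by (metis dvd_mult dvd_mult2)+
      then have "k mod 3 = 1" by presburger
      moreover have "k mod 3 = (k mod 9) mod 3" by (simp add: mod_mod_cancel)
      moreover have "r = 1 \<or> r = 4 \<or> r = 7" if "r < 9" "r mod 3 = 1" for r :: nat
        using that by presburger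
      ultimately have "k mod 9 = 1 \<or> k mod 9 = 4 \<or> k mod 9 = 7" by simp
      moreover have "5 * ?z \<le> 3 * p\<^sup>2" if "k mod 9 = 4"
      proof -
        have "4 * int k + 2 = 9 * (4 * int (k div 9) + 2)"
          using int_eq_mod_9[OF that] by simp
        then have "9 dvd 4 * int k + 2" by (metis dvd_triv_left)
        then have "?z \<le> 2" using True
          by (intro index_of_appearance_le) (auto simp: numeral_2_eq_2)
        then show ?thesis using True by simp
      qed
      ultimately show ?thesis using 1 by (auto simp: cong_def)
    next
      case False
      then have "p \<ge> 5" using p3 by presburger
      then have "5 * p \<le> p\<^sup>2" by (simp add: power2_eq_square)
      then show ?thesis using z 1 by linarith
    qed
  qed
  then show "3 * ?z \<le> 2 * p\<^sup>2"
    and "\<not> ([k = 1] (mod 9) \<or> [k = 7] (mod 9)) \<Longrightarrow> 5 * ?z \<le> 3 * p\<^sup>2" by auto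
qed

text \<open>An index at which \<open>2p\<^sup>2\<close> appears must be even. With \<open>h = (p - 1)/2\<close>, doubling is affordable
when \<open>p\<close> divides \<open>U\<^sub>h\<close>, and not required when it divides \<open>U\<^sub>h\<^sub>+\<^sub>1\<close> with \<open>h + 1\<close> even. The remaining
case needs \<open>p \<equiv> 1\<close> modulo 4.\<close>
lemma unramified_index_double_sq:
  assumes p: "prime p" "\<not> p dvd k * (k + 1)"
  shows "index_of_appearance k (2 * p\<^sup>2) \<le> p\<^sup>2 \<or>
    (p mod 4 = 1 \<and> index_of_appearance k (2 * p\<^sup>2) \<le> p\<^sup>2 + p)"
proof -
  have p3: "odd p" "p \<ge> 3" using unramified_odd[OF p] by auto
  then obtain h where h: "p = 2 * h + 1" by (auto elim: oddE)
  have h1: "h \<ge> 1" using p3 h by simp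
  have "int p dvd U k h \<or> int p dvd U k (h + 1)"
    using prime_dvd_U_half[OF p] by (simp add: h)
  then show ?thesis
  proof
    assume "int p dvd U k h"
    then have "index_of_appearance k (2 * p\<^sup>2) \<le> 2 * p * h"
      using even_index_sq(1)[OF p(1) p3(1) _ h1] by simp
    also have "\<dots> \<le> p\<^sup>2" by (simp add: h power2_eq_square algebra_simps)
    finally show ?thesis by simp
  next
    assume a: "int p dvd U k (h + 1)"
    show ?thesis
    proof (cases "even (h + 1)")
      case True
      then have "index_of_appearance k (2 * p\<^sup>2) \<le> p * (h + 1)"
        using even_index_sq(2)[OF p(1) p3(1) a] by simp
      also have "\<dots> \<le> p * p" using h h1 by (intro mult_le_mono) auto
      finally show ?thesis by (simp add: power2_eq_square)
    next
      case False
      then have "p mod 4 = 1" using h by presburger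
      moreover have "index_of_appearance k (2 * p\<^sup>2) \<le> 2 * p * (h + 1)"
        using even_index_sq(1)[OF p(1) p3(1) a] by simp
      moreover have "2 * p * (h + 1) = p\<^sup>2 + p" by (simp add: h power2_eq_square algebra_simps)
      ultimately show ?thesis by simp
    qed
  qed
qed

text \<open>In the only case with ratio above 1/2 the ratio is at most \<open>(p + 1)/(2p)\<close> and
\<open>p \<equiv> 1\<close> modulo 4. This is 3/5 for \<open>p = 5\<close> and at most 7/13 for the other primes, the next one being 13. If
\<open>k\<close> is 0 or 4 modulo 5, then 5 is ramified; if it is 2, then 5 divides \<open>U\<^sub>2\<close>.\<close>
lemma index_double_sq_bounds:
  assumes p: "prime p" and lt: "index_of_appearance k (2 * p\<^sup>2) < 2 * p\<^sup>2"
  shows "5 * index_of_appearance k (2 * p\<^sup>2) \<le> 3 * (2 * p\<^sup>2)"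
    and "[k = 0] (mod 5) \<or> [k = 2] (mod 5) \<or> [k = 4] (mod 5) \<Longrightarrow>
      13 * index_of_appearance k (2 * p\<^sup>2) \<le> 7 * (2 * p\<^sup>2)"
proof -
  let ?z = "index_of_appearance k (2 * p\<^sup>2)"
  have "5 * ?z \<le> 3 * (2 * p\<^sup>2) \<and>
    ([k = 0] (mod 5) \<or> [k = 2] (mod 5) \<or> [k = 4] (mod 5) \<longrightarrow> 13 * ?z \<le> 7 * (2 * p\<^sup>2))"
  proof (cases "p dvd k * (k + 1)")
    case True
    then have *: "p = 3" "exceptional k" using ramified_early_sq[OF p _ _ lt] by auto
    have "?z \<le> 6"
    proof -
      have "9 dvd U k 6"
        using exceptional_9_dvd_U_3[OF *(2)] U_dvd_U_mult[of k 3 2] dvd_trans by fastforce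
      moreover have "2 dvd U k 6" using U_parity[of k 6] by simp
      ultimately have "2 * 9 dvd U k 6" by (intro divides_mult) (simp_all add: coprime_left_2_iff_odd)
      then show ?thesis using *(1) by (intro index_of_appearance_le) auto
    qed
    then show ?thesis using *(1) by simp
  next
    case False
    have p3: "odd p" "p \<ge> 3" using unramified_odd[OF p False] by auto
    show ?thesis
    proof (cases "?z \<le> p\<^sup>2")
      case True
      then show ?thesis by linarith
    next
      case nle: False
      then have z: "p mod 4 = 1" "?z \<le> p\<^sup>2 + p"
        using unramified_index_double_sq[OF p False] by auto
      show ?thesis
      proof (cases "p \<ge> 13")
        case True
        then have "13 * p \<le> p\<^sup>2" by (simp add: power2_eq_square)
        then show ?thesis using z(2) by linarith
      next
        case False
        have "p \<noteq> 9"
          using p primes_dvd_imp_eq[of 3 p] by auto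
        then have p5: "p = 5" using z(1) p3 False by presburger
        have "?z \<le> 30" using z(2) p5 by simp
        moreover have "\<not> 5 dvd k" "\<not> 5 dvd k + 1"
          using \<open>\<not> p dvd _\<close> p5 by (metis dvd_mult dvd_mult2)+
        moreover have "k mod 5 \<noteq> 2"
        proof
          assume "k mod 5 = 2"
          then have "5 dvd 4 * int k + 2" by presburger
          then have "int p dvd U k 2" by (simp add: p5 numeral_2_eq_2)
          then have "?z \<le> 2 * p * 2" using even_index_sq(1)[OF p p3(1), of k 2] by simp
          then show False using nle p5 by simp
        qed
        ultimately show ?thesis using p5 by (auto simp: cong_def) presburger+
      qed
    qed
  qed
  then show "5 * ?z \<le> 3 * (2 * p\<^sup>2)"
    and "[k = 0] (mod 5) \<or> [k = 2] (mod 5) \<or> [k = 4] (mod 5) \<Longrightarrow> 13 * ?z \<le> 7 * (2 * p\<^sup>2)"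
    by blast+
qed

lemma unramified_index_lt:
  assumes p: "prime p" "\<not> p dvd k * (k + 1)"
  shows "index_of_appearance k (p\<^sup>2) < p\<^sup>2" and "index_of_appearance k (2 * p\<^sup>2) < 2 * p\<^sup>2"
proof -
  have "p \<ge> 3" using unramified_odd[OF p] by simp
  then have "3 * p \<le> p\<^sup>2" "p > 0" by (auto simp: power2_eq_square)
  moreover have "2 * index_of_appearance k (p\<^sup>2) \<le> p\<^sup>2 + p"
    using unramified_index_sq[OF p] by (simp add: power2_eq_square)
  moreover have "index_of_appearance k (2 * p\<^sup>2) \<le> p\<^sup>2 + p"
    using unramified_index_double_sq[OF p] by linarith
  ultimately show "index_of_appearance k (p\<^sup>2) < p\<^sup>2"
    and "index_of_appearance k (2 * p\<^sup>2) < 2 * p\<^sup>2" by linarith+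
qed

section \<open>The two suprema\<close>

lemma ex_unramified_prime:
  fixes k :: nat
  assumes "k > 0"
  shows "\<exists>p. prime p \<and> \<not> p dvd k * (k + 1)"
proof -
  obtain p where p: "prime p" "p > k + 1" using bigger_prime[of "k + 1"] by blast
  then have "\<not> p dvd k" "\<not> p dvd k + 1" using assms by (auto dest: dvd_imp_le)
  then show ?thesis using p(1) prime_dvd_mult_iff by blast
qed

lemma nat_ratio_le: "d > 0 \<Longrightarrow> b * z \<le> a * d \<Longrightarrow> b > 0 \<Longrightarrow> real z / real d \<le> real a / real b"
proof -
  assume "d > 0" "b * z \<le> a * d" "b > 0"
  then have "real b * real z \<le> real a * real d" by (metis of_nat_le_iff of_nat_mult)
  then show ?thesis using \<open>d > 0\<close> \<open>b > 0\<close> by (simp add: field_simps)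
qed

lemma sigma_le:
  assumes "k > 0" "b > 0"
    and bound: "\<And>p. prime p \<Longrightarrow> index_of_appearance k (p\<^sup>2) < p\<^sup>2 \<Longrightarrow>
      b * index_of_appearance k (p\<^sup>2) \<le> a * p\<^sup>2"
  shows "sigma k \<le> real a / real b"
  unfolding sigma_def
proof (rule cSup_least)
  show "{real (index_of_appearance k (p\<^sup>2)) / real (p\<^sup>2) | p.
      prime p \<and> index_of_appearance k (p\<^sup>2) < p\<^sup>2} \<noteq> {}"
    using ex_unramified_prime[OF assms(1)] unramified_index_lt(1) by blast
  show "x \<le> real a / real b" if "x \<in> {real (index_of_appearance k (p\<^sup>2)) / real (p\<^sup>2) | p.
      prime p \<and> index_of_appearance k (p\<^sup>2) < p\<^sup>2}" for x
    using that nat_ratio_le[OF _ bound assms(2)] by (auto simp del: of_nat_power simp: prime_gt_0_nat)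
qed

lemma tau_le:
  assumes "k > 0" "b > 0"
    and bound: "\<And>p. prime p \<Longrightarrow> index_of_appearance k (2 * p\<^sup>2) < 2 * p\<^sup>2 \<Longrightarrow>
      b * index_of_appearance k (2 * p\<^sup>2) \<le> a * (2 * p\<^sup>2)"
  shows "tau k \<le> real a / real b"
  unfolding tau_def
proof (rule cSup_least)
  show "{real (index_of_appearance k (2 * p\<^sup>2)) / real (2 * p\<^sup>2) | p.
      prime p \<and> index_of_appearance k (2 * p\<^sup>2) < 2 * p\<^sup>2} \<noteq> {}"
    using ex_unramified_prime[OF assms(1)] unramified_index_lt(2) by blast
  show "x \<le> real a / real b" if "x \<in> {real (index_of_appearance k (2 * p\<^sup>2)) / real (2 * p\<^sup>2) | p.
      prime p \<and> index_of_appearance k (2 * p\<^sup>2) < 2 * p\<^sup>2}" for x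
    using that nat_ratio_le[OF _ bound assms(2)]
    by (auto simp del: of_nat_power of_nat_mult simp: prime_gt_0_nat)
qed

lemma le_sigma:
  assumes "prime p" "index_of_appearance k (p\<^sup>2) < p\<^sup>2"
  shows "real (index_of_appearance k (p\<^sup>2)) / real (p\<^sup>2) \<le> sigma k"
  unfolding sigma_def
proof (rule cSup_upper)
  show "bdd_above {real (index_of_appearance k (p\<^sup>2)) / real (p\<^sup>2) | p.
      prime p \<and> index_of_appearance k (p\<^sup>2) < p\<^sup>2}"
    by (rule bdd_aboveI[of _ 1]) (auto simp del: of_nat_power simp: divide_le_eq_1 prime_gt_0_nat)
qed (use assms in blast)

lemma le_tau:
  assumes "prime p" "index_of_appearance k (2 * p\<^sup>2) < 2 * p\<^sup>2"
  shows "real (index_of_appearance k (2 * p\<^sup>2)) / real (2 * p\<^sup>2) \<le> tau k"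
  unfolding tau_def
proof (rule cSup_upper)
  show "bdd_above {real (index_of_appearance k (2 * p\<^sup>2)) / real (2 * p\<^sup>2) | p.
      prime p \<and> index_of_appearance k (2 * p\<^sup>2) < 2 * p\<^sup>2}"
    by (rule bdd_aboveI[of _ 1]) (auto simp del: of_nat_power of_nat_mult simp: divide_le_eq_1 prime_gt_0_nat)
qed (use assms in blast)

text \<open>Attained at \<open>p = 3\<close>: for these residues 9 divides none of \<open>U\<^sub>1, \<dots>, U\<^sub>5\<close>.\<close>
lemma sigma_eq:
  assumes "k > 0" "[k = 1] (mod 9) \<or> [k = 7] (mod 9)"
  shows "sigma k = 2 / 3"
proof (rule antisym)
  show "sigma k \<le> 2 / 3"
    using sigma_le[OF assms(1), of 3 2] index_sq_bounds(1) by simp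
next
  have k: "k mod 9 = 1 \<or> k mod 9 = 7" using assms(2) by (simp add: cong_def)
  define z where "z = index_of_appearance k (3\<^sup>2)"
  have z: "z \<ge> 1" "9 dvd U k z"
    using index_of_appearance_dvd[of "3\<^sup>2" k] by (simp_all add: z_def)
  have u: "\<not> 3 dvd k * (k + 1)"
  proof
    assume "3 dvd k * (k + 1)"
    then have "3 dvd k \<or> 3 dvd k + 1" using prime_dvd_mult_iff[of "3::nat" k "k + 1"] by simp
    then show False using k by presburger
  qed
  have "z \<ge> 6"
  proof (rule ccontr)
    assume "\<not> z \<ge> 6"
    then have zc: "z = 1 \<or> z = 2 \<or> z = 3 \<or> z = 4 \<or> z = 5" using z(1) by linarith
    \<comment> \<open>modulo 9 the coefficient \<open>4k + 2\<close> of the recurrence is 6 or 3\<close>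
    define c where "c = (if k mod 9 = 1 then 6 else 3 :: int)"
    have c: "[4 * int k + 2 = c] (mod 9)"
    proof -
      have "4 * int k + 2 - c = 9 * (4 * int (k div 9))
          \<or> 4 * int k + 2 - c = 9 * (4 * int (k div 9) + 3)"
        using k int_eq_mod_9[of k 1] int_eq_mod_9[of k 7] by (auto simp: c_def)
      then show ?thesis unfolding cong_iff_dvd_diff by (metis dvd_triv_left)
    qed
    have rec: "[U k (Suc (Suc i)) = c * b - a] (mod 9)"
      if "[U k i = a] (mod 9)" "[U k (Suc i) = b] (mod 9)" for i a b
      unfolding U.simps(3) using c that by (intro cong_diff cong_mult)
    have 2: "[U k 2 = c] (mod 9)" using c by (simp add: numeral_2_eq_2)
    have 3: "[U k 3 = c * c - 1] (mod 9)" using rec[of 1 1 c] 2 by (simp add: eval_nat_numeral)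
    have 4: "[U k 4 = c * (c * c - 1) - c] (mod 9)" using rec[of 2 c "c * c - 1"] 2 3 by (simp add: eval_nat_numeral)
    have 5: "[U k 5 = c * (c * (c * c - 1) - c) - (c * c - 1)] (mod 9)"
      using rec[OF 3, of "c * (c * c - 1) - c"] 4 by (simp add: eval_nat_numeral)
    show False
      using zc z(2) cong_dvd_iff[OF 2, of] cong_dvd_iff[OF 3] cong_dvd_iff[OF 4] cong_dvd_iff[OF 5]
      by (auto simp: c_def split: if_splits)
  qed
  then have "2 / 3 \<le> real z / real (3\<^sup>2)" by simp
  also have "\<dots> \<le> sigma k"
    using le_sigma[of 3 k] unramified_index_lt(1)[of 3 k] u unfolding z_def by simp
  finally show "2 / 3 \<le> sigma k" .
qed

section \<open>The bounds and values of the discriminator\<close>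

lemma eq_least_of_mem:
  fixes S :: "nat set"
  assumes "D \<in> S" "n \<le> D" and "\<And>m. m \<in> S \<Longrightarrow> n \<le> m \<Longrightarrow> D \<le> m"
  shows "D = (LEAST m. m \<ge> n \<and> m \<in> S)"
  using assms by (intro Least_equality[symmetric]) auto

theorem theorem5:
  fixes k n :: nat
  assumes "k > 2" and "n \<ge> 1"
  shows "discriminator k n \<le> (LEAST m. m \<ge> n \<and> m \<in> A_set k \<union> B_set k)
    \<and> ((\<exists>m \<in> A_set k \<union> B_set k. n \<le> m \<and> real m < real n / sigma k)
         \<longrightarrow> discriminator k n = (LEAST m. m \<ge> n \<and> m \<in> A_set k \<union> B_set k))
    \<and> ([k = 1] (mod 9) \<or> [k = 7] (mod 9) \<longrightarrow> sigma k = 2 / 3)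
    \<and> (\<not> ([k = 1] (mod 9) \<or> [k = 7] (mod 9)) \<longrightarrow> sigma k \<le> 3 / 5)
    \<and> (even (discriminator k n) \<longrightarrow>
         discriminator k n \<le> (LEAST m. m \<ge> n \<and> m \<in> B_set k)
         \<and> ((\<exists>m \<in> B_set k. n \<le> m \<and> real m < real n / tau k)
              \<longrightarrow> discriminator k n = (LEAST m. m \<ge> n \<and> m \<in> B_set k)))
    \<and> ([k = 0] (mod 5) \<or> [k = 2] (mod 5) \<or> [k = 4] (mod 5) \<longrightarrow> tau k \<le> 7 / 13)
    \<and> tau k \<le> 3 / 5"
proof -
  define D where "D = discriminator k n"
  have k0: "k > 0" using assms(1) by simp
  have exB: "2 ^ Suc n \<ge> n \<and> 2 ^ Suc n \<in> B_set k"
  proof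
    show "n \<le> 2 ^ Suc n" by (rule less_imp_le, rule less_trans[OF less_exp]) simp
    show "2 ^ Suc n \<in> B_set k" by (rule power2_in_B_set) simp
  qed
  have exAB: "2 ^ Suc n \<ge> n \<and> 2 ^ Suc n \<in> A_set k \<union> B_set k" using exB by blast
  have leAB: "D \<le> m" if "m \<in> A_set k \<union> B_set k" "n \<le> m" for m
    using discriminator_le_AB[OF that] D_def by simp
  have le1: "D \<le> (LEAST m. m \<ge> n \<and> m \<in> A_set k \<union> B_set k)"
    using LeastI[of "\<lambda>m. m \<ge> n \<and> m \<in> A_set k \<union> B_set k", OF exAB] leAB by blast
  have le2: "D \<le> (LEAST m. m \<ge> n \<and> m \<in> B_set k)"
    using LeastI[of "\<lambda>m. m \<ge> n \<and> m \<in> B_set k", OF exB] leAB by blast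
  \<comment> \<open>covers \<open>s \<le> 0\<close> too, where the quotient is nonpositive (0 if \<open>s = 0\<close>)\<close>
  have not_small: "m \<ge> real n / s" if "real n \<le> r * real D" "r \<le> s" "real D \<le> m" for r s m
  proof (cases "s > 0")
    case True
    have "real n \<le> s * real D" using that(1,2) by (meson mult_right_mono of_nat_0_le_iff order_trans)
    also have "\<dots> \<le> s * m" using True that(3) by simp
    finally show ?thesis using True by (simp add: field_simps)
  next
    case False
    then have "real n / s \<le> 0" by (simp add: divide_nonneg_nonpos)
    then show ?thesis using that(3) of_nat_0_le_iff[of D, where ?'a = real] by linarith
  qed
  have memAB: "D \<in> A_set k \<union> B_set k"
    if m: "m \<in> A_set k \<union> B_set k" "n \<le> m" "real m < real n / sigma k" for m
  proof (rule ccontr)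
    assume "D \<notin> A_set k \<union> B_set k"
    then obtain p where p: "prime p" "\<not> p dvd k * (k + 1)" "p\<^sup>2 dvd D"
      using discriminator_AB_or_square[OF assms(2)] unfolding D_def by blast
    have "real m \<ge> real n / sigma k"
      using not_small discriminator_le_index_ratio p(3) le_sigma[OF p(1) unramified_index_lt(1)[OF p(1,2)]]
        leAB[OF m(1,2)] unfolding D_def by (metis of_nat_le_iff)
    then show False using m(3) by simp
  qed
  have memB: "D \<in> B_set k"
    if ev: "even D" and m: "m \<in> B_set k" "n \<le> m" "real m < real n / tau k" for m
  proof (rule ccontr)
    assume "D \<notin> B_set k"
    then have "D \<notin> A_set k \<union> B_set k" using ev by (simp add: A_set_iff)
    then obtain p where p: "prime p" "\<not> p dvd k * (k + 1)" "p\<^sup>2 dvd D"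
      using discriminator_AB_or_square[OF assms(2)] unfolding D_def by blast
    have "coprime 2 (p\<^sup>2)" using unramified_odd[OF p(1,2)] by (simp add: coprime_left_2_iff_odd)
    then have "2 * p\<^sup>2 dvd D" using ev p(3) by (simp add: divides_mult)
    then have "real m \<ge> real n / tau k"
      using not_small discriminator_le_index_ratio le_tau[OF p(1) unramified_index_lt(2)[OF p(1,2)]]
        leAB[of m] m(1,2) unfolding D_def by (metis of_nat_le_iff UnI2)
    then show False using m(3) by simp
  qed
  have nD: "n \<le> D" using discriminator_ge D_def by simp
  have "D = (LEAST m. m \<ge> n \<and> m \<in> A_set k \<union> B_set k)"
    if "\<exists>m \<in> A_set k \<union> B_set k. n \<le> m \<and> real m < real n / sigma k"
    using that memAB leAB nD by (intro eq_least_of_mem) blast+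
  moreover have "D = (LEAST m. m \<ge> n \<and> m \<in> B_set k)"
    if "even D" "\<exists>m \<in> B_set k. n \<le> m \<and> real m < real n / tau k"
    using that memB leAB nD by (intro eq_least_of_mem) blast+
  moreover have "\<not> ([k = 1] (mod 9) \<or> [k = 7] (mod 9)) \<Longrightarrow> sigma k \<le> 3 / 5"
    using sigma_le[OF k0, of 5 3] index_sq_bounds(2) by simp
  moreover have "[k = 0] (mod 5) \<or> [k = 2] (mod 5) \<or> [k = 4] (mod 5) \<Longrightarrow> tau k \<le> 7 / 13"
    using tau_le[OF k0, of 13 7] index_double_sq_bounds(2) by simp
  moreover have "tau k \<le> 3 / 5"
    using tau_le[OF k0, of 5 3] index_double_sq_bounds(1) by simp
  ultimately show ?thesis
    using le1 le2 sigma_eq[OF k0] unfolding D_def by blast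
qed

end
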